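(* Let $2\le k\le n$ be integers and $\Omega\subset\mathbb{R}^n$ open. A function $u\in C^2(\Omega)$ is $k$-convex if and only if it is $\mathcal{A}_k$-admissible. In other words, $$\Gamma_{\mathcal{A}_k}=\overline{\Gamma}_k,$$ that is, for $M\in S^n(\mathbb{R})$ one has $\inf_{A\in\mathcal{A}_k}\operatorname{trace}(A^tMA)>-\infty$ if and only if $\lambda(M)\in\overline{\Gamma}_k$.
   Context: $S^n(\mathbb{R})$ is the set of real symmetric $n\times n$ matrices, $S^n_+(\mathbb{R})$ the subset of positive semi-definite ones. $\lambda(M)=(\lambda_1(M),\dots,\lambda_n(M))$ is the vector of eigenvalues of $M$ (order immaterial here). $\sigma_j$ is the $j$-th elementary symmetric polynomial in $n$ variables, $\sigma_{k-1,i}(\gamma)=\sigma_{k-1}(\gamma_1,\dots,\gamma_{i-1},0,\gamma_{i+1},\dots,\gamma_n)$, $\Gamma_k=\{\lambda\in\mathbb{R}^n:\sigma_j(\lambda)>0\text{ for all }j=1,\dots,k\}$, with closure $\overline{\Gamma}_k=\{\lambda\in\mathbb{R}^n:\sigma_j(\lambda)\ge0\text{ for all }j=1,\dots,k\}$; a symmetric matrix $M$ is said to be in $\overline{\Gamma}_k$ if $\lambda(M)\in\overline{\Gamma}_k$. Further, $$\mathcal{A}_k=\Big\{A\in S^n_+(\mathbb{R}):\lambda_i^2(A)=\sigma_{k-1,i}(\gamma)\ (i=1,\dots,n)\text{ with }\gamma\in\Gamma_k\text{ and }\sigma_k(\gamma)=1\Big\}$$ and $\Gamma_{\mathcal{A}_k}=\{M\in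 S^n(\mathbb{R}):\inf_{A\in\mathcal{A}_k}\operatorname{trace}(A^tMA)>-\infty\}$. A function $u\in C^2(\Omega)$ is $k$-convex if $D^2u(x)\in\overline{\Gamma}_k$ for every $x\in\Omega$, and $\mathcal{A}_k$-admissible if $D^2u(x)\in\Gamma_{\mathcal{A}_k}$ for every $x\in\Omega$. *)

theory Defs
  imports
    "HOL-Analysis.Analysis"
    "HOL-Computational_Algebra.Fundamental_Theorem_Algebra"
begin

definition symmetric_mat :: "real^'n^'n \<Rightarrow> bool" where
  "symmetric_mat M \<longleftrightarrow> transpose M = M"

definition psd_mat :: "real^'n^'n \<Rightarrow> bool" where
  "psd_mat M \<longleftrightarrow> symmetric_mat M \<and> (\<forall>x. 0 \<le> x \<bullet> (M *v x))"

definition charpoly :: "'a::comm_ring_1^'n^'n \<Rightarrow> 'a poly" where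
  "charpoly M = det (mat [:0, 1:] - (\<chi> i j. [:M $ i $ j:]))"

text \<open>The eigenvalues, repeated according to algebraic multiplicity, in some order; for symmetric
  matrices such a vector exists by the lemma \<open>charpoly_eigenvalues\<close> below.\<close>

definition eigenvalues :: "real^'n^'n \<Rightarrow> real^'n" where
  "eigenvalues M = (SOME l. charpoly M = (\<Prod>i\<in>UNIV. [:- (l $ i), 1:]))"

definition esym :: "nat \<Rightarrow> real^'n \<Rightarrow> real" where
  "esym j l = (\<Sum>S | card S = j. \<Prod>i\<in>S. l $ i)"

definition esym_omit :: "nat \<Rightarrow> 'n \<Rightarrow> real^'n \<Rightarrow> real" where
  "esym_omit j i l = esym j (\<chi> m. if m = i then 0 else l $ m)"

definition Gamma_cone :: "nat \<Rightarrow> (real^'n) set" where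
  "Gamma_cone k = {l. \<forall>j\<in>{1..k}. 0 < esym j l}"

definition Gamma_bar :: "nat \<Rightarrow> (real^'n) set" where
  "Gamma_bar k = {l. \<forall>j\<in>{1..k}. 0 \<le> esym j l}"

definition Gamma_bar_mat :: "nat \<Rightarrow> (real^'n^'n) set" where
  "Gamma_bar_mat k = {M. symmetric_mat M \<and> eigenvalues M \<in> Gamma_bar k}"

definition A_set :: "nat \<Rightarrow> (real^'n^'n) set" where
  "A_set k = {A. psd_mat A \<and>
     (\<exists>\<gamma>\<in>Gamma_cone k. esym k \<gamma> = 1 \<and> (\<forall>i. (eigenvalues A $ i)\<^sup>2 = esym_omit (k - 1) i \<gamma>))}"

definition Gamma_A :: "(real^'n^'n) set \<Rightarrow> (real^'n^'n) set" where
  "Gamma_A \<A> = {M. symmetric_mat M \<and>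
     (INF A\<in>\<A>. ereal (trace (transpose A ** M ** A))) > -\<infinity>}"

definition partial_deriv :: "'n \<Rightarrow> (real^'n \<Rightarrow> real) \<Rightarrow> real^'n \<Rightarrow> real" where
  "partial_deriv i f x = frechet_derivative f (at x) (axis i 1)"

definition C1_on :: "(real^'n) set \<Rightarrow> (real^'n \<Rightarrow> real) \<Rightarrow> bool" where
  "C1_on \<Omega> f \<longleftrightarrow> (\<forall>x\<in>\<Omega>. f differentiable at x) \<and> (\<forall>i. continuous_on \<Omega> (partial_deriv i f))"

definition C2_on :: "(real^'n) set \<Rightarrow> (real^'n \<Rightarrow> real) \<Rightarrow> bool" where
  "C2_on \<Omega> f \<longleftrightarrow> C1_on \<Omega> f \<and> (\<forall>i. C1_on \<Omega> (partial_deriv i f))"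

definition hessian :: "(real^'n \<Rightarrow> real) \<Rightarrow> real^'n \<Rightarrow> real^'n^'n" where
  "hessian u x = (\<chi> i j. partial_deriv i (partial_deriv j u) x)"

definition k_convex :: "nat \<Rightarrow> (real^'n) set \<Rightarrow> (real^'n \<Rightarrow> real) \<Rightarrow> bool" where
  "k_convex k \<Omega> u \<longleftrightarrow> (\<forall>x\<in>\<Omega>. hessian u x \<in> Gamma_bar_mat k)"

definition admissible :: "(real^'n^'n) set \<Rightarrow> (real^'n) set \<Rightarrow> (real^'n \<Rightarrow> real) \<Rightarrow> bool" where
  "admissible \<A> \<Omega> u \<longleftrightarrow> (\<forall>x\<in>\<Omega>. hessian u x \<in> Gamma_A \<A>)"

lemma poly_charpoly: "poly (charpoly M) x = det (mat x - M)"
proof -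
  have "poly (charpoly M) x =
      (\<Sum>p | p permutes UNIV. of_int (sign p) *
        (\<Prod>i\<in>UNIV. poly ((mat [:0, 1:] - (\<chi> i j. [:M $ i $ j:])) $ i $ p i) x))"
    by (simp add: charpoly_def det_def poly_sum poly_prod)
  also have "\<dots> = det (mat x - M)"
    unfolding det_def by (intro sum.cong prod.cong arg_cong2[where f="(*)"] refl) (simp add: mat_def)
  finally show ?thesis .
qed

lemma charpoly_monic:
  fixes M :: "'a::{idom}^'n^'n"
  shows "degree (charpoly M) = CARD('n) \<and> lead_coeff (charpoly M) = 1"
proof -
  let ?n = "CARD('n)"
  define P where "P = (mat [:0, 1:] - (\<chi> i j. [:M $ i $ j:]) :: 'a poly^'n^'n)"
  define t where "t p = of_int (sign p) * (\<Prod>i\<in>UNIV. P $ i $ p i)" for p :: "'n \<Rightarrow> 'n"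
  have t_id: "t id = (\<Prod>i\<in>UNIV. [:- (M $ i $ i), 1:])"
    by (simp add: t_def P_def mat_def sign_id)
  have deg_id: "degree (t id) = ?n"
    unfolding t_id by (subst degree_prod_sum_eq) auto
  have lc_id: "coeff (t id) ?n = 1"
    using lead_coeff_prod[of "\<lambda>i. [:- (M $ i $ i), 1:]" UNIV] deg_id by (simp add: t_id)
  have deg_t: "degree (t p) < ?n" if "p permutes UNIV" "p \<noteq> id" for p
  proof -
    obtain a where a: "p a \<noteq> a" using \<open>p \<noteq> id\<close> by (auto simp: fun_eq_iff)
    have "degree (t p) \<le> degree (\<Prod>i\<in>UNIV. P $ i $ p i)"
      by (cases "sign p = 1") (auto simp: t_def sign_def)
    also have "\<dots> \<le> (\<Sum>i\<in>UNIV. degree (P $ i $ p i))"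
      using degree_prod_sum_le[of UNIV "\<lambda>i. P $ i $ p i"] by (simp add: o_def)
    also have "\<dots> < (\<Sum>i\<in>(UNIV::'n set). 1)"
    proof (rule sum_strict_mono_ex1)
      show "\<forall>i\<in>UNIV. degree (P $ i $ p i) \<le> 1"
        by (auto simp: P_def mat_def)
      show "\<exists>i\<in>UNIV. degree (P $ i $ p i) < 1"
        using a by (intro bexI[of _ a]) (auto simp: P_def mat_def)
    qed auto
    finally show ?thesis by simp
  qed
  have fin: "finite {p. p permutes (UNIV::'n set)}" by (simp add: finite_permutations)
  have idin: "id \<in> {p. p permutes (UNIV::'n set)}" by (simp add: permutes_id)
  have split: "charpoly M = t id + (\<Sum>p\<in>{p. p permutes UNIV} - {id}. t p)"
    unfolding charpoly_def det_def P_def[symmetric] t_def[symmetric]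
    by (rule sum.remove[OF fin idin])
  have "degree (\<Sum>p\<in>{p. p permutes UNIV} - {id}. t p) < ?n"
    by (rule degree_sum_less) (auto simp: deg_t)
  with deg_id lc_id show ?thesis
    by (simp add: split degree_add_eq_left coeff_eq_0)
qed

lemma det_of_real: "det (\<chi> i j. complex_of_real (M $ i $ j)) = complex_of_real (det (M::real^'n^'n))"
  by (simp add: det_def)

lemma symmetric_charpoly_root_real:
  fixes M :: "real^'n^'n"
  assumes sym: "symmetric_mat M"
    and root: "poly (charpoly (\<chi> i j. complex_of_real (M $ i $ j))) z = 0"
  shows "z \<in> \<real>"
proof -
  define C where "C = (\<chi> i j. complex_of_real (M $ i $ j))"
  have Msym: "M $ i $ j = M $ j $ i" for i j
    using sym unfolding symmetric_mat_def by (metis transpose_def vec_lambda_beta)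
  have "det (mat z - C) = 0" using root by (simp add: poly_charpoly C_def)
  then obtain v where v: "(mat z - C) *v v = 0" "v \<noteq> 0"
    using matrix_left_invertible_ker[of "mat z - C"] invertible_det_nz[of "mat z - C"]
      invertible_left_inverse[of "mat z - C"] by blast
  have ev: "(\<Sum>j\<in>UNIV. C $ i $ j * v $ j) = z * v $ i" for i
  proof -
    have "0 = (\<Sum>j\<in>UNIV. (mat z - C) $ i $ j * v $ j)"
      using v(1) by (simp add: matrix_vector_mult_def vec_eq_iff)
    also have "\<dots> = (\<Sum>j\<in>UNIV. (if i = j then z * v $ j else 0)) - (\<Sum>j\<in>UNIV. C $ i $ j * v $ j)"
      unfolding sum_subtractf[symmetric] by (intro sum.cong refl) (simp add: mat_def algebra_simps)
    finally show ?thesis by simp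
  qed
  define q where "q = (\<Sum>i\<in>UNIV. \<Sum>j\<in>UNIV. cnj (v $ i) * C $ i $ j * v $ j)"
  define s where "s = (\<Sum>i\<in>UNIV. (cmod (v $ i))\<^sup>2)"
  have "cnj q = (\<Sum>i\<in>UNIV. \<Sum>j\<in>UNIV. cnj (v $ j) * C $ j $ i * v $ i)"
    by (simp add: q_def C_def Msym mult_ac)
  also have "\<dots> = q" unfolding q_def by (rule sum.swap)
  finally have qreal: "q \<in> \<real>" by (simp add: Reals_cnj_iff)
  have "q = (\<Sum>i\<in>UNIV. cnj (v $ i) * (z * v $ i))"
    by (simp add: q_def ev[symmetric] sum_distrib_left mult_ac)
  also have "\<dots> = z * of_real s"
    by (simp add: s_def sum_distrib_left complex_norm_square mult_ac flip: of_real_power)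
  finally have qz: "q = z * of_real s" .
  have "s \<noteq> 0"
    using v(2) by (auto simp: s_def sum_nonneg_eq_0_iff vec_eq_iff)
  then have "z = q / of_real s" using qz by simp
  with qreal show ?thesis by simp
qed

lemma charpoly_eigenvalues:
  fixes M :: "real^'n^'n"
  assumes sym: "symmetric_mat M"
  shows "charpoly M = (\<Prod>i\<in>UNIV. [:- (eigenvalues M $ i), 1:])"
proof -
  define C where "C = (\<chi> i j. complex_of_real (M $ i $ j))"
  obtain r where r: "smult (lead_coeff (charpoly C)) (\<Prod>i<degree (charpoly C). [:- r i, 1:]) = charpoly C"
    by (rule complex_poly_decompose')
  then have r: "charpoly C = (\<Prod>i<CARD('n). [:- r i, 1:])"
    using charpoly_monic[of C] by (metis smult_1_left)
  obtain h :: "'n \<Rightarrow> nat" where h: "bij_betw h UNIV {..<CARD('n)}"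
    using ex_bij_betw_finite_nat[of "UNIV::'n set"] by (auto simp: atLeast0LessThan)
  have r': "charpoly C = (\<Prod>i\<in>UNIV. [:- r (h i), 1:])"
    unfolding r by (rule prod.reindex_bij_betw[OF h, symmetric])
  have "r (h i) \<in> \<real>" for i
    using symmetric_charpoly_root_real[OF sym, of "r (h i)"]
    unfolding C_def[symmetric] r' by (auto simp: poly_prod)
  then have re: "r (h i) = of_real (Re (r (h i)))" for i by (simp add: of_real_Re)
  define l :: "real^'n" where "l = (\<chi> i. Re (r (h i)))"
  have "poly (charpoly M) x = poly (\<Prod>i\<in>UNIV. [:- (l $ i), 1:]) x" for x
  proof -
    have "complex_of_real (poly (charpoly M) x) = det (\<chi> i j. complex_of_real ((mat x - M) $ i $ j))"
      by (simp only: poly_charpoly det_of_real)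
    also have "(\<chi> i j. complex_of_real ((mat x - M) $ i $ j)) = mat (of_real x) - C"
      by (simp add: vec_eq_iff mat_def C_def)
    also have "det (mat (of_real x) - C) = (\<Prod>i\<in>UNIV. of_real x - r (h i))"
      by (simp add: poly_charpoly[symmetric] r' poly_prod)
    also have "\<dots> = (\<Prod>i\<in>UNIV. of_real (x - l $ i))"
      by (intro prod.cong refl) (subst re, simp add: l_def)
    also have "\<dots> = of_real (poly (\<Prod>i\<in>UNIV. [:- (l $ i), 1:]) x)"
      by (simp add: poly_prod)
    finally show ?thesis by (simp only: of_real_eq_iff)
  qed
  then have "charpoly M = (\<Prod>i\<in>UNIV. [:- (l $ i), 1:])"
    by (simp add: poly_eq_poly_eq_iff[symmetric] fun_eq_iff)
  then show ?thesis unfolding eigenvalues_def by (rule someI)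
qed

end

theory Submission
  imports Defs
begin

text \<open>
  If \<open>A\<close> has eigenvalues \<open>a\<close> with \<open>a i\<^sup>2 = \<sigma>\<^bsub>k-1,i\<^esub>(\<gamma>)\<close> and eigenbasis \<open>Q\<close>, then
  \<open>trace (A\<^sup>T M A) = \<Sum>i. \<sigma>\<^bsub>k-1,i\<^esub>(\<gamma>) d i\<close>, where \<open>d\<close> is the diagonal of \<open>Q\<^sup>T M Q\<close>. For fixed
  weights, minimising this over all orthogonal \<open>Q\<close> leads to a diagonal \<open>Q\<^sup>T M Q\<close>, so \<open>d\<close> may be
  replaced by a permutation of \<open>\<lambda>(M)\<close>, and everything reduces to vectors.

  If \<open>\<lambda>(M)\<close> lies in the closed cone, the sum is nonnegative by Garding's inequality. It follows
  from the superadditivity of \<open>\<sigma>\<^sub>k / \<sigma>\<^bsub>k-1\<^esub>\<close> on \<open>\<Gamma>\<^sub>k\<close> (Marcus and Lopes), which makes \<open>\<sigma>\<^sub>k\<close> increasing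
  along directions of the cone; the only analytic input is Newton's inequality for real numbers.

  If \<open>\<mu> = \<lambda>(M)\<close> lies outside, move along \<open>e = (1, \<dots>, 1)\<close> until \<open>x = \<mu> + t e\<close> first meets the
  closed cone. Then \<open>\<sigma>\<^sub>k(x) = 0\<close>, and for \<open>\<gamma> = x + s e\<close> the sum equals
  \<open>k \<sigma>\<^sub>k(\<gamma>) - (t + s) (n - k + 1) \<sigma>\<^bsub>k-1\<^esub>(\<gamma>)\<close>. After normalising \<open>\<sigma>\<^sub>k(\<gamma>)\<close> to 1 this tends to \<open>-\<infinity>\<close> as
  \<open>s\<close> tends to 0, unless \<open>x = 0\<close>; in that case \<open>M\<close> is a negative multiple of the identity, and
  perturbing a coordinate vector instead of \<open>x\<close> works.
\<close>

subsection \<open>Elementary symmetric polynomials over a finite index set\<close>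

text \<open>The index set is a parameter so that omitting a coordinate is \<open>S - {i}\<close> and
  inductions may pass to smaller sets.\<close>

definition es :: "'a set \<Rightarrow> nat \<Rightarrow> ('a \<Rightarrow> real) \<Rightarrow> real" where
  "es S j x = (\<Sum>T | T \<subseteq> S \<and> card T = j. \<Prod>i\<in>T. x i)"

lemma es_0 [simp]: "finite S \<Longrightarrow> es S 0 x = 1"
proof -
  assume "finite S"
  then have "{T. T \<subseteq> S \<and> card T = 0} = {{}}"
    by (auto dest: finite_subset)
  then show ?thesis by (simp add: es_def)
qed

lemma es_cong: "(\<And>i. i \<in> S \<Longrightarrow> x i = y i) \<Longrightarrow> es S j x = es S j y"
  unfolding es_def by (intro sum.cong prod.cong) auto

lemma es_empty_Suc [simp]: "es {} (Suc j) x = 0"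
proof -
  have "{T. T \<subseteq> {} \<and> card T = Suc j} = {}" by auto
  then show ?thesis by (simp add: es_def)
qed

lemma es_insert:
  assumes "finite S" "a \<notin> S"
  shows "es (insert a S) (Suc j) x = es S (Suc j) x + x a * es S j x"
proof -
  let ?A = "{T. T \<subseteq> S \<and> card T = Suc j}" and ?B = "{T. T \<subseteq> S \<and> card T = j}"
  have fin: "finite ?A" "finite ?B" using assms(1) by auto
  have finT: "finite T" if "T \<subseteq> S" for T using that assms(1) finite_subset by blast
  have "{T. T \<subseteq> insert a S \<and> card T = Suc j} = ?A \<union> insert a ` ?B"
  proof (intro set_eqI iffI)
    fix T assume T: "T \<in> {T. T \<subseteq> insert a S \<and> card T = Suc j}"
    show "T \<in> ?A \<union> insert a ` ?B"
    proof (cases "a \<in> T")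
      case True
      then have "T = insert a (T - {a})" "T - {a} \<in> ?B" using T by auto
      then show ?thesis by blast
    qed (use T in auto)
  next
    fix T assume "T \<in> ?A \<union> insert a ` ?B"
    then show "T \<in> {T. T \<subseteq> insert a S \<and> card T = Suc j}"
      using assms finT by (auto simp: card_insert_if)
  qed
  moreover have "?A \<inter> insert a ` ?B = {}" using assms by auto
  moreover have "inj_on (insert a) ?B"
    using assms by (auto simp: inj_on_def insert_ident)
  moreover have "(\<Prod>i\<in>insert a T. x i) = x a * (\<Prod>i\<in>T. x i)" if "T \<in> ?B" for T
    using that assms finT by (subst prod.insert) auto
  ultimately show ?thesis
    using fin by (simp add: es_def sum.union_disjoint sum.reindex sum_distrib_left)
qed

lemma es_remove:
  assumes "finite S" "a \<in> S"
  shows "es S (Suc j) x = es (S - {a}) (Suc j) x + x a * es (S - {a}) j x"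
  using es_insert[of "S - {a}" a j x] assms by (simp add: insert_absorb)

lemma es_1: "finite S \<Longrightarrow> es S (Suc 0) x = sum x S"
  by (induction S rule: finite_induct) (simp_all add: es_insert)

lemma sum_squares_eq_es:
  "finite S \<Longrightarrow> (\<Sum>i\<in>S. (x i)\<^sup>2) = (es S 1 x)\<^sup>2 - 2 * es S 2 x"
proof (induction S rule: finite_induct)
  case (insert a S)
  then have "es (insert a S) 2 x = es S 2 x + x a * es S 1 x"
    using es_insert[of S a 1 x] by (simp add: numeral_2_eq_2)
  with insert show ?case
    by (simp add: es_insert) (simp add: power2_eq_square algebra_simps)
qed (simp_all add: numeral_2_eq_2)

text \<open>Double counting of the pairs \<open>(T, i)\<close> with \<open>i \<in> T\<close>: such a
  pair amounts to \<open>i\<close> together with \<open>T - {i}\<close>. Different choices of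
  \<open>h\<close> yield Euler's identity and the gradient formula.\<close>

lemma sum_card_Suc_subsets:
  fixes h :: "'a \<Rightarrow> 'a set \<Rightarrow> 'b::comm_monoid_add"
  assumes "finite S"
  shows "(\<Sum>T | T \<subseteq> S \<and> card T = Suc k. \<Sum>i\<in>T. h i (T - {i})) =
    (\<Sum>i\<in>S. \<Sum>T | T \<subseteq> S - {i} \<and> card T = k. h i T)"
proof -
  have fT: "finite T" if "T \<subseteq> S" for T using that assms finite_subset by blast
  have c: "card (insert i T) = Suc (card T)" if "T \<subseteq> S - {i}" for i T
    using that fT[of T] by (subst card_insert_disjoint) auto
  have "(\<Sum>T | T \<subseteq> S \<and> card T = Suc k. \<Sum>i\<in>T. h i (T - {i})) =
     (\<Sum>(T, i)\<in>Sigma {T. T \<subseteq> S \<and> card T = Suc k} (\<lambda>T. T). h i (T - {i}))"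
    using assms fT by (subst sum.Sigma) auto
  also have "\<dots> = (\<Sum>(i, T)\<in>Sigma S (\<lambda>i. {T. T \<subseteq> S - {i} \<and> card T = k}). h i T)"
    by (rule sum.reindex_bij_witness[where i = "\<lambda>(i, T). (insert i T, i)" and j = "\<lambda>(T, i). (i, T - {i})"])
      (use fT c in \<open>auto simp: insert_absorb\<close>)
  also have "\<dots> = (\<Sum>i\<in>S. \<Sum>T | T \<subseteq> S - {i} \<and> card T = k. h i T)"
    using assms by (subst sum.Sigma) auto
  finally show ?thesis .
qed

lemma es_euler:
  assumes "finite S"
  shows "(\<Sum>i\<in>S. x i * es (S - {i}) k x) = real (Suc k) * es S (Suc k) x"
proof -
  have "(\<Sum>i\<in>S. x i * es (S - {i}) k x) =
     (\<Sum>T | T \<subseteq> S \<and> card T = Suc k. \<Sum>i\<in>T. x i * (\<Prod>j\<in>T - {i}. x j))"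
    using sum_card_Suc_subsets[OF assms, of "\<lambda>i T. x i * (\<Prod>j\<in>T. x j)" k]
    by (simp add: es_def sum_distrib_left)
  also have "\<dots> = (\<Sum>T | T \<subseteq> S \<and> card T = Suc k. \<Sum>i\<in>T. (\<Prod>j\<in>T. x j))"
  proof (intro sum.cong refl)
    fix T i assume "T \<in> {T. T \<subseteq> S \<and> card T = Suc k}" "i \<in> T"
    then show "x i * (\<Prod>j\<in>T - {i}. x j) = (\<Prod>j\<in>T. x j)"
      using assms finite_subset[of T S] by (subst prod.remove[of T i]) auto
  qed
  also have "\<dots> = real (Suc k) * es S (Suc k) x"
    by (simp add: es_def sum_distrib_left)
  finally show ?thesis .
qed

text \<open>Splitting off the subsets that contain \<open>i\<close> reduces the sum to Euler's
  identity.\<close>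

lemma sum_es_omit:
  assumes "finite S"
  shows "(\<Sum>i\<in>S. es (S - {i}) k x) = (real (card S) - real k) * es S k x"
proof (cases k)
  case 0
  with assms show ?thesis by simp
next
  case (Suc m)
  have "(\<Sum>i\<in>S. es (S - {i}) k x) = (\<Sum>i\<in>S. es S k x - x i * es (S - {i}) m x)"
    using es_remove[OF assms, of _ m x] by (intro sum.cong) (auto simp: Suc)
  also have "\<dots> = real (card S) * es S k x - real k * es S k x"
    by (simp add: sum_subtractf es_euler[OF assms] Suc)
  finally show ?thesis by (simp add: algebra_simps)
qed

text \<open>Exhibits the weighted sums of the trace functional as directional derivatives: omitting
  \<open>i\<close> and lowering the degree by one is differentiation in coordinate
  \<open>i\<close>.\<close>

lemma es_has_derivative:
  assumes "finite S"
  shows "((\<lambda>s. es S (Suc k) (\<lambda>i. x i + s * y i)) has_field_derivative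
           (\<Sum>i\<in>S. es (S - {i}) k x * y i)) (at 0)"
proof -
  have "((\<lambda>s. \<Prod>i\<in>T. x i + s * y i) has_field_derivative (\<Sum>i\<in>T. y i * (\<Prod>j\<in>T - {i}. x j))) (at 0)" for T
    by (rule DERIV_cong[OF has_field_derivative_prod[where f' = "\<lambda>i. y i"]])
      (auto intro!: derivative_eq_intros)
  then have "((\<lambda>s. es S (Suc k) (\<lambda>i. x i + s * y i)) has_field_derivative
     (\<Sum>T | T \<subseteq> S \<and> card T = Suc k. \<Sum>i\<in>T. y i * (\<Prod>j\<in>T - {i}. x j))) (at 0)"
    unfolding es_def by (intro DERIV_sum) auto
  also have "(\<Sum>T | T \<subseteq> S \<and> card T = Suc k. \<Sum>i\<in>T. y i * (\<Prod>j\<in>T - {i}. x j)) =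
     (\<Sum>i\<in>S. es (S - {i}) k x * y i)"
    using sum_card_Suc_subsets[OF assms, of "\<lambda>i T. y i * (\<Prod>j\<in>T. x j)" k]
    by (simp add: es_def sum_distrib_left mult.commute)
  finally show ?thesis .
qed

lemma es_scale: "es S k (\<lambda>i. c * x i) = c ^ k * es S k x"
  unfolding es_def sum_distrib_left
  by (intro sum.cong refl) (auto simp: prod.distrib)

subsection \<open>Newton's inequality\<close>

text \<open>Complex coefficients make the fundamental theorem of algebra available. The zero
  polynomial is excluded, since every complex number is a root of it.\<close>

definition real_rooted :: "complex poly \<Rightarrow> bool" where
  "real_rooted p \<longleftrightarrow> (\<forall>i. coeff p i \<in> \<real>) \<and> (\<forall>z. poly p z = 0 \<longrightarrow> z \<in> \<real>)"

lemma real_rooted_decompose: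
  assumes "real_rooted p"
  obtains c r n where "p = smult (of_real c) (\<Prod>i<n. [:- of_real (r i), 1:])" "c \<noteq> 0" "n = degree p"
proof -
  obtain r where r: "smult (lead_coeff p) (\<Prod>i<degree p. [:- r i, 1:]) = p"
    by (rule complex_poly_decompose')
  have p0: "p \<noteq> 0" using assms complex_is_Real_iff[of \<i>]
    by (metis imaginary_unit.sel(2) poly_0 real_rooted_def zero_neq_one)
  obtain c where c: "lead_coeff p = of_real c"
    using assms by (auto simp: real_rooted_def Reals_def)
  have "r i \<in> \<real>" if "i < degree p" for i
  proof -
    have "poly (smult (lead_coeff p) (\<Prod>i<degree p. [:- r i, 1:])) (r i) = 0"
      using that by (auto simp: poly_prod)
    then show ?thesis using assms unfolding r by (simp add: real_rooted_def)
  qed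
  then have "(\<Prod>i<degree p. [:- r i, 1:]) = (\<Prod>i<degree p. [:- of_real (Re (r i)), 1:])"
    by (intro prod.cong) auto
  then have "p = smult (of_real c) (\<Prod>i<degree p. [:- of_real (Re (r i)), 1:])"
    using r c by metis
  moreover have "c \<noteq> 0" using p0 c by auto
  ultimately show ?thesis using that[of c "\<lambda>i. Re (r i)" "degree p"] by blast
qed

text \<open>The Gauss--Lucas argument: the imaginary part of the logarithmic derivative
  is \<open>- Im z * (\<Sum>i. 1 / \<bar>z - r i\<bar>\<^sup>2)\<close>, so it does not vanish off the real line.\<close>

lemma real_rooted_pderiv:
  assumes p: "real_rooted p" and "pderiv p \<noteq> 0"
  shows "real_rooted (pderiv p)"
proof -
  obtain c r n where eq: "p = smult (of_real c) (\<Prod>i<n. [:- of_real (r i), 1:])" and c: "c \<noteq> 0"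
    and n: "n = degree p"
    using real_rooted_decompose[OF p] .
  have "degree p \<noteq> 0" using assms(2) pderiv_eq_0_iff by blast
  then have npos: "n > 0" using n by simp
  have "z \<in> \<real>" if z: "poly (pderiv p) z = 0" for z
  proof (rule ccontr)
    assume nr: "z \<notin> \<real>"
    have nz: "z - of_real (r i) \<noteq> 0" for i using nr by auto
    have "0 = of_real c * (\<Sum>i<n. \<Prod>j\<in>{..<n} - {i}. z - of_real (r j))"
      using z by (simp add: eq pderiv_smult pderiv_prod poly_sum poly_prod pderiv_pCons)
    then have "0 = (\<Sum>i<n. \<Prod>j\<in>{..<n} - {i}. z - of_real (r j))" using c by simp
    also have "\<dots> = (\<Sum>i<n. (\<Prod>j<n. z - of_real (r j)) * inverse (z - of_real (r i)))"
    proof (intro sum.cong refl)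
      fix i assume "i \<in> {..<n}"
      then show "(\<Prod>j\<in>{..<n} - {i}. z - of_real (r j)) =
          (\<Prod>j<n. z - of_real (r j)) * inverse (z - of_real (r i))"
        using nz[of i] by (subst prod.remove[of "{..<n}" i]) auto
    qed
    also have "\<dots> = (\<Prod>j<n. z - of_real (r j)) * (\<Sum>i<n. inverse (z - of_real (r i)))"
      by (simp add: sum_distrib_left)
    finally have "(\<Sum>i<n. inverse (z - of_real (r i))) = 0" using nz by auto
    then have "Im (\<Sum>i<n. inverse (z - of_real (r i))) = 0" by simp
    then have "Im z * (\<Sum>i<n. 1 / ((Re z - r i)\<^sup>2 + (Im z)\<^sup>2)) = 0"
      by (simp add: sum_distrib_left sum_negf)
    moreover have "Im z \<noteq> 0" using nr complex_is_Real_iff by blast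
    moreover have "(\<Sum>i<n. 1 / ((Re z - r i)\<^sup>2 + (Im z)\<^sup>2)) > 0"
      using npos \<open>Im z \<noteq> 0\<close> by (intro sum_pos) (auto intro!: divide_pos_pos add_nonneg_pos)
    ultimately show False by simp
  qed
  moreover have "coeff (pderiv p) i \<in> \<real>" for i
    using p by (auto simp: real_rooted_def coeff_pderiv intro!: Reals_mult)
  ultimately show ?thesis by (simp add: real_rooted_def)
qed

text \<open>Laguerre's inequality f'^2 \<ge> f f'' at 0, the coefficient of degree 2 being f''(0)/2.
  A further linear factor with root r turns the defect D into c^2 + r^2 D, with c the constant
  coefficient; there is no division, so roots at 0 are allowed.\<close>

lemma laguerre_coeffs:
  fixes r :: "nat \<Rightarrow> real"
  defines "f \<equiv> \<lambda>n. \<Prod>i<n. [:- r i, 1:]"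
  shows "2 * coeff (f n) 0 * coeff (f n) 2 \<le> (coeff (f n) 1)\<^sup>2"
proof (induction n)
  case (Suc n)
  let ?g = "f n"
  have f: "f (Suc n) = [:- r n, 1:] * ?g" by (simp add: f_def)
  have "coeff (f (Suc n)) 0 = - r n * coeff ?g 0"
    "coeff (f (Suc n)) 1 = coeff ?g 0 - r n * coeff ?g 1"
    "coeff (f (Suc n)) 2 = coeff ?g 1 - r n * coeff ?g 2"
    by (simp_all add: f numeral_2_eq_2)
  moreover have "(coeff ?g 0 - r n * coeff ?g 1)\<^sup>2 - 2 * (- r n * coeff ?g 0) * (coeff ?g 1 - r n * coeff ?g 2)
     = (coeff ?g 0)\<^sup>2 + (r n)\<^sup>2 * ((coeff ?g 1)\<^sup>2 - 2 * coeff ?g 0 * coeff ?g 2)"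
    by (simp add: power2_eq_square algebra_simps)
  moreover have "\<dots> \<ge> 0" using Suc by simp
  ultimately show ?case by (simp only:)
qed (simp add: f_def)

lemma real_rooted_laguerre:
  assumes "real_rooted p"
  shows "2 * Re (coeff p 0) * Re (coeff p 2) \<le> (Re (coeff p 1))\<^sup>2"
proof -
  obtain c r n where eq: "p = smult (of_real c) (\<Prod>i<n. [:- of_real (r i), 1:])"
    and "c \<noteq> 0" "n = degree p"
    using real_rooted_decompose[OF assms] .
  have "coeff (\<Prod>i<n. [:- complex_of_real (r i), 1:]) j = of_real (coeff (\<Prod>i<n. [:- r i, 1:]) j)" for n j
  proof (induction n arbitrary: j)
    case (Suc n)
    then show ?case
      by (cases j) (simp_all add: mult_pCons_right mult.commute)
  qed (simp add: coeff_1)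
  then have "Re (coeff p j) = c * coeff (\<Prod>i<n. [:- r i, 1:]) j" for j
    by (simp add: eq)
  moreover have "c\<^sup>2 * (2 * coeff (\<Prod>i<n. [:- r i, 1:]) 0 * coeff (\<Prod>i<n. [:- r i, 1:]) 2)
     \<le> c\<^sup>2 * (coeff (\<Prod>i<n. [:- r i, 1:]) 1)\<^sup>2"
    by (intro mult_left_mono laguerre_coeffs) simp
  ultimately show ?thesis by (simp add: power2_eq_square algebra_simps)
qed

lemma coeff_prod_es:
  "finite S \<Longrightarrow> coeff (\<Prod>i\<in>S. [:1, complex_of_real (x i):]) j = of_real (es S j x)"
proof (induction S arbitrary: j rule: finite_induct)
  case empty
  then show ?case by (cases j) (simp_all add: coeff_1)
next
  case (insert a S)
  then show ?case by (cases j) (simp_all add: es_insert)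
qed

text \<open>The generating polynomial with factors 1 + x_i t has only real roots, and zero entries
  of \<open>x\<close> merely lower its degree. Differentiating \<open>j\<close> times keeps the
  roots real and moves \<sigma>_j, \<sigma>_(j+1), \<sigma>_(j+2) to the three lowest coefficients,
  where Laguerre's inequality applies.\<close>

lemma es_newton:
  assumes S: "finite S"
  shows "es S j x * es S (Suc (Suc j)) x \<le> (es S (Suc j) x)\<^sup>2"
proof -
  define p where "p = (\<Prod>i\<in>S. [:1, complex_of_real (x i):])"
  have "z \<in> \<real>" if z: "poly p z = 0" for z
  proof -
    obtain i where "1 + z * of_real (x i) = 0"
      using z S by (auto simp: p_def poly_prod)
    then have "z * of_real (x i) = -1" by (simp add: add_eq_0_iff)
    then have "z = of_real (- 1 / x i)"
      by (cases "x i = 0") (auto simp: field_simps)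
    then show ?thesis by (metis Reals_of_real)
  qed
  then have rr: "real_rooted p" by (simp add: real_rooted_def p_def coeff_prod_es S)
  have c: "Re (coeff p i) = es S i x" for i by (simp add: p_def coeff_prod_es S)
  \<comment> \<open>A derivative may vanish identically, which \<open>real_rooted\<close> rules out;
    the next inequality is then trivial.\<close>
  have "(pderiv ^^ m) p = 0 \<or> real_rooted ((pderiv ^^ m) p)" for m
    by (induction m) (use rr real_rooted_pderiv in auto)
  then have "2 * Re (coeff ((pderiv ^^ j) p) 0) * Re (coeff ((pderiv ^^ j) p) 2)
       \<le> (Re (coeff ((pderiv ^^ j) p) 1))\<^sup>2"
    using real_rooted_laguerre by (metis coeff_0 mult_zero_right order_refl zero_complex.sel(1) zero_power2)
  moreover have "Re (coeff ((pderiv ^^ j) p) i) = pochhammer (real (Suc i)) j * es S (i + j) x" for i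
    by (simp add: coeff_higher_pderiv c pochhammer_of_nat flip: of_nat_Suc)
  ultimately have "2 * (pochhammer 1 j * es S j x) * (pochhammer 3 j * es S (Suc (Suc j)) x)
     \<le> (pochhammer 2 j * es S (Suc j) x)\<^sup>2"
    by (simp add: numeral_3_eq_3 del: of_nat_Suc) simp
  moreover have "pochhammer (1::real) j = fact j" by (simp add: pochhammer_fact)
  moreover have "pochhammer (2::real) j = fact j * (real j + 1)"
    using pochhammer_rec[of "1::real" j] pochhammer_fact[of "Suc j", where 'a=real]
    by (simp add: algebra_simps)
  moreover have "pochhammer (3::real) j = fact j * (real j + 1) * (real j + 2) / 2"
    using pochhammer_rec[of "1::real" "Suc j"] pochhammer_rec[of "2::real" j] pochhammer_fact[of "Suc (Suc j)", where 'a=real]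
    by (simp add: algebra_simps)
  ultimately have "(fact j)\<^sup>2 * (real j + 1) * ((real j + 2) * (es S j x * es S (Suc (Suc j)) x))
      \<le> (fact j)\<^sup>2 * (real j + 1) * ((real j + 1) * (es S (Suc j) x)\<^sup>2)"
    by (simp add: power2_eq_square algebra_simps)
  then have *: "(real j + 2) * (es S j x * es S (Suc (Suc j)) x) \<le> (real j + 1) * (es S (Suc j) x)\<^sup>2"
    by (subst (asm) mult_le_cancel_left_pos) auto
  show ?thesis
  proof (cases "es S j x * es S (Suc (Suc j)) x \<le> 0")
    case False
    then have "(real j + 1) * (es S j x * es S (Suc (Suc j)) x) \<le> (real j + 2) * (es S j x * es S (Suc (Suc j)) x)"
      by (intro mult_right_mono) auto
    with * have "(real j + 1) * (es S j x * es S (Suc (Suc j)) x) \<le> (real j + 1) * (es S (Suc j) x)\<^sup>2"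
      by linarith
    then show ?thesis by (subst (asm) mult_le_cancel_left_pos) auto
  qed (use zero_le_power2[of "es S (Suc j) x"] in linarith)
qed

subsection \<open>Garding cones\<close>

text \<open>Index 0 contributes only the value 1 on a finite set, and including it lets inductions
  on \<open>k\<close> start at 0.\<close>

definition Gam :: "nat \<Rightarrow> 'a set \<Rightarrow> ('a \<Rightarrow> real) \<Rightarrow> bool" where
  "Gam k S x \<longleftrightarrow> (\<forall>j\<le>k. 0 < es S j x)"

definition Gam_bar :: "nat \<Rightarrow> 'a set \<Rightarrow> ('a \<Rightarrow> real) \<Rightarrow> bool" where
  "Gam_bar k S x \<longleftrightarrow> (\<forall>j\<le>k. 0 \<le> es S j x)"

lemma Gam_mono: "Gam k S x \<Longrightarrow> j \<le> k \<Longrightarrow> Gam j S x"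
  by (auto simp: Gam_def)

text \<open>Induction on the degree: the first failure of positivity on \<open>S - {a}\<close>,
  combined with positivity of two consecutive functions on \<open>S\<close>, would contradict
  Newton's inequality on \<open>S - {a}\<close>.\<close>

lemma Gam_omit:
  assumes S: "finite S" "a \<in> S" and G: "Gam (Suc k) S x"
  shows "Gam k (S - {a}) x"
proof -
  have "j \<le> k \<Longrightarrow> 0 < es (S - {a}) j x" for j
  proof (induction j)
    case 0
    then show ?case using S by simp
  next
    case (Suc j)
    let ?e = "\<lambda>j. es (S - {a}) j x"
    have e0: "0 < ?e j" using Suc by simp
    have "0 < ?e (Suc j) + x a * ?e j" "0 < ?e (Suc (Suc j)) + x a * ?e (Suc j)"
      using G Suc.prems unfolding es_remove[OF S, symmetric] by (auto simp: Gam_def)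
    note pos = this
    show ?case
    proof (rule ccontr)
      assume "\<not> 0 < ?e (Suc j)"
      then have neg: "?e (Suc j) \<le> 0" by simp
      \<comment> \<open>Multiplied by \<open>?e (Suc j)\<close> and \<open>?e j\<close>, the two
        positive expressions share the term in \<open>x a\<close>, which cancels.\<close>
      have "?e (Suc j) * (?e (Suc j) + x a * ?e j) \<le> 0"
        using neg pos(1) by (simp add: mult_nonpos_nonneg)
      moreover have "0 < ?e j * (?e (Suc (Suc j)) + x a * ?e (Suc j))" using e0 pos(2) by simp
      ultimately have "(?e (Suc j))\<^sup>2 < ?e j * ?e (Suc (Suc j))"
        by (simp add: power2_eq_square algebra_simps)
      then show False using es_newton[of "S - {a}" j x] S by simp
    qed
  qed
  then show ?thesis by (simp add: Gam_def)
qed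

section \<open>Superadditivity of consecutive quotients and Garding's inequality on the open
  cone\<close>

lemma square_divide_add_le:
  fixes x y :: real
  assumes "0 < v" "0 < w"
  shows "(x + y)\<^sup>2 / (v + w) \<le> x\<^sup>2 / v + y\<^sup>2 / w"
proof -
  have "x\<^sup>2 / v + y\<^sup>2 / w - (x + y)\<^sup>2 / (v + w) = (x * w - y * v)\<^sup>2 / (v * w * (v + w))"
    using assms by (simp add: field_simps) (simp add: power2_eq_square algebra_simps)
  moreover have "\<dots> \<ge> 0" using assms by simp
  ultimately show ?thesis by linarith
qed

text \<open>The denominator is \<open>es S (Suc k) x / es (S - {i}) k x\<close>. This form of
  Euler's summands isolates the quotient on the smaller set, to which an induction hypothesis
  applies.\<close>

lemma es_omit_quotient:
  assumes S: "finite S" "i \<in> S" and pos: "0 < es (S - {i}) k x" "0 < es S (Suc k) x"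
  shows "0 < x i + es (S - {i}) (Suc k) x / es (S - {i}) k x"
    and "x i * es (S - {i}) (Suc k) x / es S (Suc k) x =
      x i - (x i)\<^sup>2 / (x i + es (S - {i}) (Suc k) x / es (S - {i}) k x)"
proof -
  let ?b = "es (S - {i}) k x"
  have e: "x i + es (S - {i}) (Suc k) x / ?b = es S (Suc k) x / ?b"
    using pos es_remove[OF S, of k x] by (simp add: field_simps)
  with pos show "0 < x i + es (S - {i}) (Suc k) x / ?b" by simp
  have "x i - (x i)\<^sup>2 / (es S (Suc k) x / ?b) = (x i * es S (Suc k) x - (x i)\<^sup>2 * ?b) / es S (Suc k) x"
    using pos by (simp add: field_simps)
  also have "x i * es S (Suc k) x - (x i)\<^sup>2 * ?b = x i * es (S - {i}) (Suc k) x"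
    by (simp add: es_remove[OF S, of k] power2_eq_square algebra_simps)
  finally show "x i * es (S - {i}) (Suc k) x / es S (Suc k) x =
      x i - (x i)\<^sup>2 / (x i + es (S - {i}) (Suc k) x / ?b)"
    by (simp only: e)
qed

text \<open>By Euler's identity, \<open>(k + 1) \<sigma>\<^bsub>k+1\<^esub> / \<sigma>\<^sub>k = \<Sum>i. x i - x i\<^sup>2 / (x i + q i)\<close> with
  \<open>q i = \<sigma>\<^bsub>k,i\<^esub> / \<sigma>\<^bsub>k-1,i\<^esub>\<close>, where \<open>q i\<close> is superadditive by induction and \<open>x\<^sup>2 / v\<close> is subadditive.\<close>

lemma es_quotient_superadditive:
  assumes "finite S" "Gam (Suc k) S x" "Gam (Suc k) S y"
  shows "Gam (Suc k) S (\<lambda>i. x i + y i) \<and>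
    es S (Suc k) x / es S k x + es S (Suc k) y / es S k y
      \<le> es S (Suc k) (\<lambda>i. x i + y i) / es S k (\<lambda>i. x i + y i)"
  using assms
proof (induction k arbitrary: S)
  case 0
  then show ?case
    by (auto simp: Gam_def le_Suc_eq es_1 sum.distrib intro: add_pos_pos)
next
  case (Suc k)
  let ?z = "\<lambda>i. x i + y i"
  note S = Suc.prems(1)
  let ?q = "\<lambda>x i. es (S - {i}) (Suc k) x / es (S - {i}) k x"
  \<comment> \<open>The induction hypothesis on \<open>S\<close> itself settles all degrees up to
    \<open>Suc k\<close>; on the sets \<open>S - {i}\<close> it controls the quotients
    below.\<close>
  have "Gam (Suc k) S ?z"
    using Suc.IH[OF S] Suc.prems Gam_mono by (metis le_SucI order_refl)
  have e: "0 < es S (Suc k) x" "0 < es S (Suc k) y" "0 < es S (Suc k) ?z"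
    using Suc.prems \<open>Gam (Suc k) S ?z\<close> by (auto simp: Gam_def)
  have euler: "real (Suc (Suc k)) * (es S (Suc (Suc k)) w / es S (Suc k) w) =
      (\<Sum>i\<in>S. w i * es (S - {i}) (Suc k) w / es S (Suc k) w)" for w
    using es_euler[OF S, of w "Suc k"] by (simp add: sum_divide_distrib[symmetric])
  have "x i * es (S - {i}) (Suc k) x / es S (Suc k) x + y i * es (S - {i}) (Suc k) y / es S (Suc k) y
      \<le> ?z i * es (S - {i}) (Suc k) ?z / es S (Suc k) ?z" if i: "i \<in> S" for i
  proof -
    have Gi: "Gam (Suc k) (S - {i}) x" "Gam (Suc k) (S - {i}) y"
      using Gam_omit[OF S i] Suc.prems by auto
    have IH: "Gam (Suc k) (S - {i}) ?z" "?q x i + ?q y i \<le> ?q ?z i"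
      using Suc.IH[OF _ Gi] S by auto
    have b: "0 < es (S - {i}) k x" "0 < es (S - {i}) k y" "0 < es (S - {i}) k ?z"
      using Gi IH(1) by (auto simp: Gam_def)
    note p = es_omit_quotient(1)[OF S i b(1) e(1)] es_omit_quotient(1)[OF S i b(2) e(2)]
    have "(?z i)\<^sup>2 / (?z i + ?q ?z i) \<le> (?z i)\<^sup>2 / ((x i + ?q x i) + (y i + ?q y i))"
      using IH(2) p by (intro divide_left_mono mult_pos_pos) auto
    also have "\<dots> \<le> (x i)\<^sup>2 / (x i + ?q x i) + (y i)\<^sup>2 / (y i + ?q y i)"
      by (rule square_divide_add_le[OF p])
    finally show ?thesis
      unfolding es_omit_quotient(2)[OF S i b(1) e(1)] es_omit_quotient(2)[OF S i b(2) e(2)]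
        es_omit_quotient(2)[OF S i b(3) e(3)] by linarith
  qed
  then have "real (Suc (Suc k)) * (es S (Suc (Suc k)) x / es S (Suc k) x + es S (Suc (Suc k)) y / es S (Suc k) y)
      \<le> real (Suc (Suc k)) * (es S (Suc (Suc k)) ?z / es S (Suc k) ?z)"
    unfolding distrib_left euler sum.distrib[symmetric] by (rule sum_mono)
  then have le: "es S (Suc (Suc k)) x / es S (Suc k) x + es S (Suc (Suc k)) y / es S (Suc k) y
      \<le> es S (Suc (Suc k)) ?z / es S (Suc k) ?z"
    by (subst (asm) mult_le_cancel_left_pos) auto
  \<comment> \<open>Positivity of these two quotients makes the one of \<open>?z\<close> positive,
    which supplies the missing top degree.\<close>
  have "0 < es S (Suc (Suc k)) x / es S (Suc k) x + es S (Suc (Suc k)) y / es S (Suc k) y"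
    using Suc.prems by (intro add_pos_pos divide_pos_pos) (auto simp: Gam_def)
  with le have "0 < es S (Suc (Suc k)) ?z / es S (Suc k) ?z" by linarith
  moreover have "0 < es S (Suc k) ?z" using \<open>Gam (Suc k) S ?z\<close> by (auto simp: Gam_def)
  ultimately have "0 < es S (Suc (Suc k)) ?z" by (simp add: zero_less_divide_iff)
  with \<open>Gam (Suc k) S ?z\<close> le show ?case by (auto simp: Gam_def le_Suc_eq)
qed

text \<open>\<sigma>_k is the product of the quotients \<sigma>_(j+1)/\<sigma>_j, and by
  superadditivity each of them grows when a vector of the cone is added.\<close>

lemma es_add_mono:
  assumes S: "finite S" and G: "Gam k S x" "Gam k S y"
  shows "es S k x \<le> es S k (\<lambda>i. x i + y i)"
  using G
proof (induction k)
  case 0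
  then show ?case using S by simp
next
  case (Suc k)
  let ?z = "\<lambda>i. x i + y i"
  have pos: "0 < es S k x" "0 < es S (Suc k) x" "0 < es S (Suc k) y" "0 < es S k y"
    using Suc.prems by (auto simp: Gam_def)
  have le: "es S k x \<le> es S k ?z" using Suc Gam_mono by (metis le_SucI order_refl)
  have "es S (Suc k) x / es S k x \<le> es S (Suc k) ?z / es S k ?z"
    using es_quotient_superadditive[OF S Suc.prems] pos by (smt (verit) divide_pos_pos)
  then have "es S k x * (es S (Suc k) x / es S k x) \<le> es S k ?z * (es S (Suc k) ?z / es S k ?z)"
    using le pos by (intro mult_mono) auto
  with pos le show ?case by simp
qed

lemma Gam_scale: "Gam k S x \<Longrightarrow> 0 < c \<Longrightarrow> Gam k S (\<lambda>i. c * x i)"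
  by (simp add: Gam_def es_scale)

text \<open>The sum is the derivative of \<sigma>_(k+1) at \<open>x\<close> along \<open>y\<close>;
  were it negative, \<sigma>_(k+1) would drop along \<open>y\<close>, against
  \<open>es_add_mono\<close>.\<close>

lemma garding_open:
  assumes S: "finite S" and G: "Gam (Suc k) S x" "Gam (Suc k) S y"
  shows "0 \<le> (\<Sum>i\<in>S. es (S - {i}) k x * y i)"
proof (rule ccontr)
  assume "\<not> ?thesis"
  then have "(\<Sum>i\<in>S. es (S - {i}) k x * y i) < 0" by simp
  from DERIV_neg_dec_right[OF es_has_derivative[OF S] this]
  obtain d where d: "0 < d" "\<And>h. 0 < h \<Longrightarrow> h < d \<Longrightarrow>
      es S (Suc k) (\<lambda>i. x i + h * y i) < es S (Suc k) x"
    by auto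
  have "es S (Suc k) x \<le> es S (Suc k) (\<lambda>i. x i + (d/2) * y i)"
    using d by (intro es_add_mono S G Gam_scale) auto
  with d(2)[of "d/2"] d(1) show False by simp
qed

section \<open>Translation along the all-ones vector and the closed cone\<close>

lemma card_supersets:
  assumes "finite S" "U \<subseteq> S" "card U \<le> j"
  shows "card {T. U \<subseteq> T \<and> T \<subseteq> S \<and> card T = j} = (card S - card U) choose (j - card U)"
proof -
  have fin: "finite U" "finite (S - U)" using assms finite_subset by auto
  have "bij_betw (\<lambda>T. T - U) {T. U \<subseteq> T \<and> T \<subseteq> S \<and> card T = j} {V. V \<subseteq> S - U \<and> card V = j - card U}"
  proof (rule bij_betw_byWitness[where f' = "\<lambda>V. V \<union> U"])
    show "(\<lambda>T. T - U) ` {T. U \<subseteq> T \<and> T \<subseteq> S \<and> card T = j} \<subseteq> {V. V \<subseteq> S - U \<and> card V = j - card U}"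
      using fin by (auto simp: card_Diff_subset)
    show "(\<lambda>V. V \<union> U) ` {V. V \<subseteq> S - U \<and> card V = j - card U} \<subseteq> {T. U \<subseteq> T \<and> T \<subseteq> S \<and> card T = j}"
    proof clarify
      fix V assume "V \<subseteq> S - U" "card V = j - card U"
      then show "U \<subseteq> V \<union> U \<and> V \<union> U \<subseteq> S \<and> card (V \<union> U) = j"
        using assms fin finite_subset[of V "S - U"] by (subst card_Un_disjoint) auto
    qed
  qed auto
  then show ?thesis
    using fin assms by (simp add: bij_betw_same_card n_subsets card_Diff_subset)
qed

text \<open>Expanding the products sorts the terms by the subset \<open>U\<close> on which
  \<open>x\<close> is kept; the binomial coefficient counts the sets of size \<open>j\<close> above
  \<open>U\<close>. For positive \<open>s\<close> all coefficients are nonnegative.\<close>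

lemma es_translate:
  assumes S: "finite S"
  shows "es S j (\<lambda>i. x i + s) = (\<Sum>m\<le>j. real ((card S - m) choose (j - m)) * es S m x * s ^ (j - m))"
proof -
  have fT: "finite T" if "T \<subseteq> S" for T using that S finite_subset by blast
  let ?P = "\<lambda>U. (\<Prod>i\<in>U. x i) * s ^ (j - card U)"
  have "es S j (\<lambda>i. x i + s) = (\<Sum>T | T \<subseteq> S \<and> card T = j. \<Sum>U\<in>Pow T. ?P U)"
    unfolding es_def
  proof (intro sum.cong refl)
    fix T assume "T \<in> {T. T \<subseteq> S \<and> card T = j}"
    then have T: "finite T" "card T = j" using fT by auto
    have "(\<Prod>i\<in>T. x i + s) = (\<Sum>U\<in>Pow T. (\<Prod>i\<in>U. x i) * (\<Prod>i\<in>T - U. s))"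
      by (rule prod_add[OF T(1)])
    also have "\<dots> = (\<Sum>U\<in>Pow T. ?P U)"
      using T by (intro sum.cong refl) (auto simp: card_Diff_subset finite_subset)
    finally show "(\<Prod>i\<in>T. x i + s) = (\<Sum>U\<in>Pow T. ?P U)" .
  qed
  also have "\<dots> = (\<Sum>(T, U)\<in>Sigma {T. T \<subseteq> S \<and> card T = j} Pow. ?P U)"
    using S fT by (subst sum.Sigma) auto
  also have "\<dots> = (\<Sum>(U, T)\<in>Sigma {U. U \<subseteq> S \<and> card U \<le> j} (\<lambda>U. {T. U \<subseteq> T \<and> T \<subseteq> S \<and> card T = j}). ?P U)"
    by (rule sum.reindex_bij_witness[where i = "\<lambda>(a, b). (b, a)" and j = "\<lambda>(a, b). (b, a)"])
      (auto intro: card_mono fT)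
  also have "\<dots> = (\<Sum>U | U \<subseteq> S \<and> card U \<le> j. real ((card S - card U) choose (j - card U)) * ?P U)"
    using S by (subst sum.Sigma[symmetric]) (auto intro!: sum.cong simp: card_supersets)
  also have "\<dots> = (\<Sum>(m, U)\<in>Sigma {..j} (\<lambda>m. {U. U \<subseteq> S \<and> card U = m}).
       real ((card S - card U) choose (j - card U)) * ?P U)"
    by (rule sum.reindex_bij_witness[where i = snd and j = "\<lambda>U. (card U, U)"]) auto
  also have "\<dots> = (\<Sum>m\<le>j. real ((card S - m) choose (j - m)) * es S m x * s ^ (j - m))"
    using S by (subst sum.Sigma[symmetric])
      (auto intro!: sum.cong simp: es_def sum_distrib_left sum_distrib_right mult_ac)
  finally show ?thesis .
qed

text \<open>In the expansion of \<open>es_translate\<close> the term of index 0 is a positive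
  multiple of \<open>s ^ j\<close>, because \<open>j \<le> card S\<close>, and the other terms are
  nonnegative.\<close>

lemma Gam_bar_translate:
  assumes S: "finite S" "k \<le> card S" and G: "Gam_bar k S x" and s: "0 < s"
  shows "Gam k S (\<lambda>i. x i + s)"
  unfolding Gam_def
proof (intro allI impI)
  fix j assume j: "j \<le> k"
  have "0 < real ((card S - 0) choose (j - 0)) * es S 0 x * s ^ (j - 0)"
    using S j s by (simp add: zero_less_binomial_iff)
  then show "0 < es S j (\<lambda>i. x i + s)"
    unfolding es_translate[OF S(1)] using G j s
    by (intro sum_pos2[where i = 0]) (auto simp: Gam_bar_def)
qed

lemma continuous_es: "continuous_on A (\<lambda>s. es S j (\<lambda>i. x i + s * y i))"
  unfolding es_def by (intro continuous_intros)

text \<open>Adding \<open>d\<close> to every coordinate moves \<open>y\<close> into the open cone at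
  a cost proportional to \<open>d\<close>.\<close>

lemma garding:
  assumes S: "finite S" "Suc k \<le> card S" and G: "Gam (Suc k) S x" "Gam_bar (Suc k) S y"
  shows "0 \<le> (\<Sum>i\<in>S. es (S - {i}) k x * y i)"
proof (rule field_le_epsilon)
  fix e :: real assume e: "0 < e"
  define c where "c = (\<Sum>i\<in>S. es (S - {i}) k x)"
  have c: "0 \<le> c"
    unfolding c_def using Gam_omit[OF S(1) _ G(1)] by (intro sum_nonneg) (auto simp: Gam_def intro: less_imp_le)
  \<comment> \<open>The summand 1 keeps the denominator positive when \<open>c\<close> is 0.\<close>
  define d where "d = e / (c + 1)"
  have "0 < d" using e c by (simp add: d_def)
  have "0 \<le> (\<Sum>i\<in>S. es (S - {i}) k x * (y i + d))"
    by (intro garding_open S G Gam_bar_translate \<open>0 < d\<close>)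
  also have "\<dots> = (\<Sum>i\<in>S. es (S - {i}) k x * y i) + c * d"
    by (simp add: distrib_left sum.distrib c_def sum_distrib_right)
  also have "c * d \<le> e"
    using e c by (simp add: d_def field_simps)
  finally show "0 \<le> (\<Sum>i\<in>S. es (S - {i}) k x * y i) + e" by simp
qed

text \<open>Maclaurin's inequality without binomial normalisation, by induction from Newton's. It
  serves to carry a vanishing \<sigma>_j over to \<sigma>_(j+1).\<close>

lemma Gam_maclaurin:
  assumes S: "finite S" and G: "Gam k S x"
  shows "Suc j \<le> k \<Longrightarrow> es S (Suc j) x ^ j \<le> es S j x ^ (Suc j)"
proof (induction j)
  case 0
  then show ?case using S by simp
next
  case (Suc j)
  let ?e = "\<lambda>j. es S j x"
  have pos: "0 < ?e j" "0 < ?e (Suc j)" "0 < ?e (Suc (Suc j))"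
    using Suc.prems G by (auto simp: Gam_def)
  have "?e (Suc j) ^ j * ?e (Suc (Suc j)) ^ Suc j \<le> ?e j ^ Suc j * ?e (Suc (Suc j)) ^ Suc j"
    using Suc pos by (intro mult_right_mono) auto
  also have "\<dots> = (?e j * ?e (Suc (Suc j))) ^ Suc j" by (simp only: power_mult_distrib)
  also have "\<dots> \<le> ((?e (Suc j))\<^sup>2) ^ Suc j"
    using pos by (intro power_mono es_newton S) auto
  also have "\<dots> = ?e (Suc j) ^ j * ?e (Suc j) ^ Suc (Suc j)"
    by (simp add: power_add[symmetric] power_mult[symmetric] mult_2 flip: power_Suc)
  finally show ?case using pos by (subst (asm) mult_le_cancel_left_pos) auto
qed

text \<open>Maclaurin's inequality holds for \<open>x\<close> shifted by a positive \<open>s\<close>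
  and survives the limit at 0.\<close>

lemma Gam_bar_zero_step:
  assumes S: "finite S" "k \<le> card S" and G: "Gam_bar k S x" and j: "0 < j" "Suc j \<le> k" "es S j x = 0"
  shows "es S (Suc j) x = 0"
proof -
  let ?f = "\<lambda>m s. es S m (\<lambda>i. x i + s * 1)"
  have lim: "(?f m \<longlongrightarrow> es S m x) (at_right 0)" for m
  proof -
    have "continuous_on UNIV (?f m)" by (rule continuous_es)
    then have "isCont (?f m) 0" by (simp add: continuous_on_eq_continuous_at)
    then have "(?f m \<longlongrightarrow> ?f m 0) (at 0)" by (rule isContD)
    then show ?thesis by (auto intro: tendsto_mono at_within_le_at)
  qed
  have "es S (Suc j) x ^ j \<le> es S j x ^ Suc j"
  proof (rule tendsto_le[OF _ tendsto_power[OF lim] tendsto_power[OF lim]])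
    show "\<forall>\<^sub>F s in at_right 0. ?f (Suc j) s ^ j \<le> ?f j s ^ Suc j"
      using eventually_at_right_less[of "0::real"]
    proof eventually_elim
      case (elim s)
      then show ?case
        using Gam_maclaurin[OF S(1) Gam_bar_translate[OF S G, of s] j(2)] by simp
    qed
  qed simp
  then have "es S (Suc j) x ^ j \<le> 0" using j by simp
  moreover have "0 \<le> es S (Suc j) x" using G j by (simp add: Gam_bar_def)
  ultimately show ?thesis by (metis linorder_not_le order_antisym_conv zero_less_power)
qed

lemma Gam_bar_zero:
  assumes S: "finite S" "k \<le> card S" and G: "Gam_bar k S x" and j: "0 < j" "j \<le> k" "es S j x = 0"
  shows "es S k x = 0"
  using j(2)
proof (induction k rule: dec_induct)
  case base
  show ?case by (rule j)
next
  case (step m)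
  then show ?case using Gam_bar_zero_step[OF S G, of m] j by simp
qed

subsection \<open>Unboundedness outside the closed cone\<close>

lemma es_zero: "es S (Suc j) (\<lambda>_. 0) = 0"
  using es_scale[of S "Suc j" 0 "\<lambda>_. 0"] by simp

text \<open>If \<open>j\<close> is the largest index with \<open>\<sigma>\<^sub>j(x) > 0\<close>, then \<open>\<sigma>\<^sub>k(x + s e)\<close> is of order \<open>s\<^bsup>k-j\<^esup>\<close> and
  \<open>\<sigma>\<^bsub>k-1\<^esub>(x + s e)\<close> of order \<open>s\<^bsup>k-1-j\<^esup>\<close>.\<close>

lemma es_ratio_blow_up:
  assumes S: "finite S" "k \<le> card S" and G: "Gam_bar k S x" and x1: "0 < es S 1 x"
    and k: "2 \<le> k" "es S k x = 0"
  shows "\<exists>s. 0 < s \<and> s < 1 \<and>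
    B * root k (es S k (\<lambda>i. x i + s)) ^ (k - 1) < es S (k - 1) (\<lambda>i. x i + s)"
proof (rule ccontr)
  assume "\<not> ?thesis"
  then have le: "es S (k - 1) (\<lambda>i. x i + s) \<le> B * root k (es S k (\<lambda>i. x i + s)) ^ (k - 1)"
    if "0 < s" "s < 1" for s using that by force
  let ?P = "\<lambda>j. j \<le> k \<and> 0 < es S j x"
  \<comment> \<open>Such an index exists since \<sigma>_1 is positive, and it is below
    \<open>k\<close> since \<sigma>_k vanishes.\<close>
  define j where "j = (GREATEST j. ?P j)"
  have P1: "?P 1" using k x1 by simp
  have Pj: "?P j" unfolding j_def by (rule GreatestI_nat[of ?P 1 k, OF P1]) simp
  have j1: "1 \<le> j" unfolding j_def by (rule Greatest_le_nat[of ?P 1 k, OF P1]) simp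
  have jk: "j < k" using Pj k by (metis le_neq_implies_less less_irrefl)
  have above: "es S m x = 0" if "j < m" "m \<le> k" for m
  proof (rule ccontr)
    assume "es S m x \<noteq> 0"
    with that G have "?P m" by (auto simp: Gam_bar_def order_less_le)
    then have "m \<le> j" unfolding j_def by (rule Greatest_le_nat[of ?P m k]) simp
    with that show False by simp
  qed
  define C where "C = (\<Sum>m\<le>k. real ((card S - m) choose (k - m)) * es S m x)"
  have C: "0 \<le> C" unfolding C_def using G by (intro sum_nonneg) (auto simp: Gam_bar_def)
  \<comment> \<open>Only indices up to \<open>j\<close> contribute, and for \<open>s\<close> below 1
    the power \<open>s ^ (k - j)\<close> is the largest of theirs.\<close>
  have up: "es S k (\<lambda>i. x i + s) \<le> C * s ^ (k - j)" if s: "0 < s" "s < 1" for s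
    unfolding es_translate[OF S(1)] C_def sum_distrib_right
  proof (rule sum_mono)
    fix m assume m: "m \<in> {..k}"
    show "real ((card S - m) choose (k - m)) * es S m x * s ^ (k - m)
       \<le> real ((card S - m) choose (k - m)) * es S m x * s ^ (k - j)"
    proof (cases "m \<le> j")
      case True
      then have "s ^ (k - m) \<le> s ^ (k - j)" using s by (intro power_decreasing) auto
      then show ?thesis using G m by (intro mult_left_mono) (auto simp: Gam_bar_def)
    qed (use above m in auto)
  qed
  \<comment> \<open>The coefficient of index \<open>j\<close> in the expansion of \<sigma>_(k-1);
    this single term is a lower bound.\<close>
  define c where "c = real ((card S - j) choose (k - 1 - j)) * es S j x"
  have c: "0 < c" unfolding c_def using Pj jk S by (simp add: zero_less_binomial_iff)
  have low: "c * s ^ (k - 1 - j) \<le> es S (k - 1) (\<lambda>i. x i + s)" if s: "0 < s" for s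
    unfolding es_translate[OF S(1)] c_def
    using G s jk by (intro member_le_sum) (auto simp: Gam_bar_def)
  define D where "D = B ^ k * C ^ (k - 1)"
  have main: "c ^ k \<le> D * s" if s: "0 < s" "s < 1" for s
  proof -
    let ?g = "\<lambda>i. x i + s"
    have pos: "0 < es S (k - 1) ?g" "0 < es S k ?g"
      using Gam_bar_translate[OF S G s(1)] by (auto simp: Gam_def)
    have "0 < root k (es S k ?g) ^ (k - 1)" using pos k by simp
    then have B: "0 < B" using le[OF s] pos
      by (metis less_le_trans zero_less_mult_pos2)
    \<comment> \<open>Raising to the power \<open>k\<close> removes the root; the powers of
      \<open>s\<close> on the two sides then differ by the factor \<open>s ^ j\<close>.\<close>
    have "(c * s ^ (k - 1 - j)) ^ k \<le> es S (k - 1) ?g ^ k"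
      using low[OF s(1)] c s by (intro power_mono) auto
    also have "\<dots> \<le> (B * root k (es S k ?g) ^ (k - 1)) ^ k"
      using le[OF s] pos by (intro power_mono) auto
    also have "\<dots> = B ^ k * (root k (es S k ?g) ^ k) ^ (k - 1)"
      by (simp add: power_mult_distrib power_mult[symmetric] mult.commute)
    also have "root k (es S k ?g) ^ k = es S k ?g" using pos k by (intro real_root_pow_pos2) auto
    also have "B ^ k * es S k ?g ^ (k - 1) \<le> B ^ k * (C * s ^ (k - j)) ^ (k - 1)"
      using B pos up[OF s] by (intro mult_left_mono power_mono) auto
    finally have "c ^ k * s ^ ((k - 1 - j) * k) \<le> D * s ^ ((k - j) * (k - 1))"
      by (simp add: power_mult_distrib power_mult[symmetric] D_def mult_ac)
    moreover have "(k - j) * (k - 1) = (k - 1 - j) * k + j"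
    proof -
      obtain d where "k = j + 1 + d" using jk less_iff_Suc_add[of j k] by auto
      then show ?thesis by (simp add: algebra_simps)
    qed
    ultimately have "s ^ ((k - 1 - j) * k) * c ^ k \<le> s ^ ((k - 1 - j) * k) * (D * s ^ j)"
      by (simp add: power_add mult_ac)
    then have "c ^ k \<le> D * s ^ j" using s by (subst (asm) mult_le_cancel_left_pos) auto
    also have "D * s ^ j \<le> D * s ^ 1"
      using s j1 B C by (intro mult_left_mono power_decreasing) (auto simp: D_def)
    finally show ?thesis by simp
  qed
  have "((\<lambda>s. D * s) \<longlongrightarrow> D * 0) (at_right 0)" by (intro tendsto_intros)
  moreover have "\<forall>\<^sub>F s in at_right (0::real). c ^ k \<le> D * s"
    using eventually_at_right_real[of 0 1] by (rule eventually_mono) (use main in auto)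
  ultimately have "c ^ k \<le> D * 0" by (rule tendsto_lowerbound) simp
  moreover have "0 < c ^ k" using c by (rule zero_less_power)
  ultimately show False by simp
qed

text \<open>The weighted sum is homogeneous of degree \<open>k - 1\<close> in \<open>g\<close>, so
  dividing \<open>g\<close> by the root \<open>r\<close> divides the sum by
  \<open>r ^ (k - 1)\<close>.\<close>

lemma garding_normalise:
  assumes S: "finite S" and k: "0 < k" and G: "Gam k S g"
    and less: "(\<Sum>i\<in>S. es (S - {i}) (k - 1) g * \<mu> i) < B * root k (es S k g) ^ (k - 1)"
  shows "\<exists>\<gamma>. Gam k S \<gamma> \<and> es S k \<gamma> = 1 \<and> (\<Sum>i\<in>S. es (S - {i}) (k - 1) \<gamma> * \<mu> i) < B"
proof -
  define r where "r = root k (es S k g)"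
  have pos: "0 < es S k g" using G by (simp add: Gam_def)
  then have r: "0 < r" "r ^ k = es S k g" using k by (auto simp: r_def)
  let ?\<gamma> = "\<lambda>i. inverse r * g i"
  have "(\<Sum>i\<in>S. es (S - {i}) (k - 1) ?\<gamma> * \<mu> i) = inverse r ^ (k - 1) * (\<Sum>i\<in>S. es (S - {i}) (k - 1) g * \<mu> i)"
    by (simp add: es_scale sum_distrib_left mult.assoc)
  also have "\<dots> < inverse r ^ (k - 1) * (B * r ^ (k - 1))"
    using less r by (intro mult_strict_left_mono) (auto simp: r_def)
  also have "\<dots> = B" using r by (simp add: power_inverse)
  finally have "(\<Sum>i\<in>S. es (S - {i}) (k - 1) ?\<gamma> * \<mu> i) < B" .
  moreover have "es S k ?\<gamma> = 1" using r pos by (simp add: es_scale power_inverse)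
  moreover have "Gam k S ?\<gamma>" using G r by (intro Gam_scale) auto
  ultimately show ?thesis by blast
qed

text \<open>At the least shift into the closed cone \<sigma>_k vanishes: otherwise all \<sigma>_j up
  to degree \<open>k\<close> would be positive there, and a smaller shift would do.\<close>

lemma Gam_bar_boundary:
  assumes S: "finite S" "k \<le> card S" and ng: "\<not> Gam_bar k S \<mu>"
  obtains t where "0 < t" "Gam_bar k S (\<lambda>i. \<mu> i + t)" "es S k (\<lambda>i. \<mu> i + t) = 0"
proof -
  let ?f = "\<lambda>j t. es S j (\<lambda>i. \<mu> i + t)"
  have cont: "continuous_on A (?f j)" for A j
    using continuous_es[of A S j \<mu> "\<lambda>_. 1"] by simp
  define T where "T = {t. 0 \<le> t \<and> Gam_bar k S (\<lambda>i. \<mu> i + t)}"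
  have "T = {0..} \<inter> (\<Inter>j\<in>{..k}. {t. 0 \<le> ?f j t})"
    by (auto simp: T_def Gam_bar_def)
  moreover have "closed {t. 0 \<le> ?f j t}" for j
    by (intro closed_Collect_le cont continuous_on_const)
  ultimately have "closed T" by auto
  have bdd: "bdd_below T" by (rule bdd_belowI[of _ 0]) (simp add: T_def)
  \<comment> \<open>This shift makes all coordinates nonnegative.\<close>
  have "(\<Sum>i\<in>S. \<bar>\<mu> i\<bar>) \<in> T"
  proof -
    have "0 \<le> \<mu> i + (\<Sum>i\<in>S. \<bar>\<mu> i\<bar>)" if "i \<in> S" for i
      using member_le_sum[of i S "\<lambda>i. \<bar>\<mu> i\<bar>"] that S by auto
    then show ?thesis
      unfolding T_def Gam_bar_def es_def by (auto intro!: sum_nonneg prod_nonneg)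
  qed
  then have ne: "T \<noteq> {}" by auto
  define t where "t = Inf T"
  have tT: "t \<in> T" unfolding t_def using closed_contains_Inf ne bdd \<open>closed T\<close> by blast
  then have Gt: "Gam_bar k S (\<lambda>i. \<mu> i + t)" and "0 \<le> t" by (auto simp: T_def)
  have "t \<noteq> 0"
  proof
    assume "t = 0"
    with Gt have "Gam_bar k S \<mu>" by simp
    with ng show False ..
  qed
  with \<open>0 \<le> t\<close> have t: "0 < t" by simp
  have "?f k t = 0"
  proof (rule ccontr)
    assume nz: "?f k t \<noteq> 0"
    \<comment> \<open>By \<open>Gam_bar_zero\<close>, no \<sigma>_j can vanish here unless
      \<sigma>_k does.\<close>
    have pos: "0 < ?f j t" if "j \<in> {..k}" for j
    proof (cases "j = 0")
      case False
      then have "?f j t \<noteq> 0" using Gam_bar_zero[OF S Gt, of j] nz that by blast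
      moreover have "0 \<le> ?f j t" using Gt that by (simp add: Gam_bar_def)
      ultimately show ?thesis by linarith
    qed (use S in simp)
    have lim: "(?f j \<longlongrightarrow> ?f j t) (at_left t)" for j
    proof -
      have "isCont (?f j) t" using cont[of UNIV j] by (simp add: continuous_on_eq_continuous_at)
      then show ?thesis by (auto intro: tendsto_mono at_within_le_at dest: isContD)
    qed
    have "\<forall>\<^sub>F s in at_left t. \<forall>j\<in>{..k}. 0 < ?f j s"
      using order_tendstoD(1)[OF lim pos] by (intro eventually_ball_finite ballI) auto
    moreover have "\<forall>\<^sub>F s in at_left t. s \<in> {0<..<t}" by (rule eventually_at_left_real[OF t])
    ultimately have "\<forall>\<^sub>F s in at_left t. s \<in> T \<and> s < t"
      by eventually_elim (auto simp: T_def Gam_bar_def intro: less_imp_le)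
    then obtain s where "s \<in> T" "s < t"
      using eventually_happens[of _ "at_left t"] by (auto simp: trivial_limit_at_left_real)
    then show False using cInf_lower[OF _ bdd, of s] by (simp add: t_def)
  qed
  with t Gt show ?thesis by (rule that)
qed

lemma garding_unbounded:
  assumes S: "finite S" "k \<le> card S" and k: "2 \<le> k" and ng: "\<not> Gam_bar k S \<mu>"
  shows "\<exists>\<gamma>. Gam k S \<gamma> \<and> es S k \<gamma> = 1 \<and> (\<Sum>i\<in>S. es (S - {i}) (k - 1) \<gamma> * \<mu> i) < B"
proof -
  obtain t where t: "0 < t" and Gt: "Gam_bar k S (\<lambda>i. \<mu> i + t)" and z: "es S k (\<lambda>i. \<mu> i + t) = 0"
    using Gam_bar_boundary[OF S ng] .
  define x where "x = (\<lambda>i. \<mu> i + t)"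
  define N where "N = real (card S) - real (k - 1)"
  have N: "0 < N" using S k by (auto simp: N_def)
  have Sk: "Suc (k - 1) = k" using k by simp
  show ?thesis
  proof (cases "0 < es S 1 x")
    case True
    \<comment> \<open>A bound for the root valid for every shift \<open>s\<close> below 1, fixed
      before \<open>s\<close> is chosen.\<close>
    define R where "R = root k (es S k (\<lambda>i. x i + 1))"
    \<comment> \<open>The constant is chosen so that the negative term \<open>t * N\<close> times
      \<sigma>_(k-1) outweighs the Euler term, at most \<open>real k * R * r ^ (k - 1)\<close>, and
      still leaves the sum below \<open>B * r ^ (k - 1)\<close>.\<close>
    obtain s where s: "0 < s" "s < 1" and
      blow: "(real k * R - B) / (t * N) * root k (es S k (\<lambda>i. x i + s)) ^ (k - 1) < es S (k - 1) (\<lambda>i. x i + s)"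
      using es_ratio_blow_up[OF S Gt[folded x_def] True k z[folded x_def]] by blast
    define g where "g = (\<lambda>i. x i + s)"
    define r where "r = root k (es S k g)"
    have G: "Gam k S g" unfolding g_def by (rule Gam_bar_translate[OF S Gt[folded x_def] s(1)])
    then have pos: "0 < es S k g" "0 < es S (k - 1) g" by (auto simp: Gam_def)
    then have r: "0 < r" "r ^ k = es S k g" using k by (auto simp: r_def)
    have "es S k g \<le> es S k (\<lambda>i. x i + 1)"
      unfolding g_def es_translate[OF S(1)] using s Gt
      by (intro sum_mono mult_left_mono power_mono) (auto simp: Gam_bar_def x_def)
    then have rR: "r \<le> R" unfolding r_def R_def using k by simp
    \<comment> \<open>Substitutes \<open>\<mu> i = g i - (t + s)\<close>.\<close>
    have "(\<Sum>i\<in>S. es (S - {i}) (k - 1) g * \<mu> i) =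
        (\<Sum>i\<in>S. g i * es (S - {i}) (k - 1) g) - (t + s) * (\<Sum>i\<in>S. es (S - {i}) (k - 1) g)"
      by (simp add: g_def x_def algebra_simps sum_distrib_left sum.distrib)
    also have "\<dots> = real k * es S k g - (t + s) * (N * es S (k - 1) g)"
      by (simp only: es_euler[OF S(1)] sum_es_omit[OF S(1)] Sk N_def)
    also have "\<dots> \<le> real k * es S k g - t * (N * es S (k - 1) g)"
      using s pos N by simp
    also have "\<dots> < real k * es S k g - (real k * R - B) * r ^ (k - 1)"
      using blow t N by (simp add: r_def g_def field_simps)
    also have "es S k g = r * r ^ (k - 1)" using r k by (simp add: power_eq_if)
    also have "real k * (r * r ^ (k - 1)) - (real k * R - B) * r ^ (k - 1) =
        B * r ^ (k - 1) - real k * ((R - r) * r ^ (k - 1))" by (simp add: algebra_simps)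
    also have "\<dots> \<le> B * r ^ (k - 1)" using rR r by simp
    finally show ?thesis
      using k by (intro garding_normalise[OF S(1) _ G]) (auto simp: r_def)
  next
    case False
    \<comment> \<open>With \<sigma>_1 zero and \<sigma>_2 nonnegative, the sum of squares must
      vanish; here \<open>k \<ge> 2\<close> enters.\<close>
    have x0: "es S 1 x = 0" "0 \<le> es S 2 x" using False Gt k by (auto simp: Gam_bar_def x_def not_less order_antisym)
    then have "(\<Sum>i\<in>S. (x i)\<^sup>2) \<le> 0" using sum_squares_eq_es[OF S(1), of x] by simp
    then have "(\<Sum>i\<in>S. (x i)\<^sup>2) = 0" by (simp add: order_antisym sum_nonneg)
    then have \<mu>: "\<mu> i = - t" if "i \<in> S" for i
      using that S(1) by (auto simp: sum_nonneg_eq_0_iff x_def)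
    obtain a where a: "a \<in> S" using S k by fastforce
    \<comment> \<open>A coordinate vector has \<sigma>_1 equal to 1 and all higher \<sigma>_j equal
      to 0, so the blow-up applies to it.\<close>
    let ?e = "\<lambda>i. if i = a then 1 else 0 :: real"
    have om: "es (S - {a}) (Suc j) ?e = 0" for j
      using es_cong[of "S - {a}" ?e "\<lambda>_. 0"] es_zero by (metis DiffE insertI1)
    have e: "es S (Suc j) ?e = (if j = 0 then 1 else 0)" for j
      using S by (cases j) (simp_all add: es_remove[OF S(1) a] om)
    have "0 \<le> es S j ?e" for j using S by (cases j) (simp_all add: e)
    then have Ge: "Gam_bar k S ?e" by (simp add: Gam_bar_def)
    have "es S k ?e = 0" using e[of "k - 1"] k by simp
    then obtain s where s: "0 < s" and
      blow: "(- B) / (t * N) * root k (es S k (\<lambda>i. ?e i + s)) ^ (k - 1) < es S (k - 1) (\<lambda>i. ?e i + s)"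
      using es_ratio_blow_up[OF S Ge _ k, of "(- B) / (t * N)"] e[of 0] by auto
    define g where "g = (\<lambda>i. ?e i + s)"
    have G: "Gam k S g" unfolding g_def by (rule Gam_bar_translate[OF S Ge s])
    have "(\<Sum>i\<in>S. es (S - {i}) (k - 1) g * \<mu> i) = - t * (N * es S (k - 1) g)"
      by (simp add: \<mu> sum_negf sum_distrib_right[symmetric] sum_es_omit[OF S(1)] N_def)
    also have "\<dots> < B * root k (es S k g) ^ (k - 1)"
      using blow t N by (simp add: g_def field_simps)
    finally show ?thesis
      using k by (intro garding_normalise[OF S(1) _ G]) auto
  qed
qed

subsection \<open>Permutations and the cones of vectors\<close>

lemma es_reindex:
  assumes "inj_on \<pi> S"
  shows "es (\<pi> ` S) j x = es S j (\<lambda>i. x (\<pi> i))"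
proof -
  have inj: "inj_on \<pi> T" if "T \<subseteq> S" for T using assms that inj_on_subset by blast
  have "bij_betw (image \<pi>) {T. T \<subseteq> S \<and> card T = j} {T. T \<subseteq> \<pi> ` S \<and> card T = j}"
  proof (rule bij_betw_imageI)
    show "inj_on (image \<pi>) {T. T \<subseteq> S \<and> card T = j}"
      using inj_on_image_Pow[OF assms] by (rule inj_on_subset) auto
    show "image \<pi> ` {T. T \<subseteq> S \<and> card T = j} = {T. T \<subseteq> \<pi> ` S \<and> card T = j}"
      using inj by (auto simp: subset_image_iff card_image)
  qed
  from sum.reindex_bij_betw[OF this, of "\<lambda>T. \<Prod>i\<in>T. x i"]
  have "es (\<pi> ` S) j x = (\<Sum>T | T \<subseteq> S \<and> card T = j. \<Prod>i\<in>\<pi> ` T. x i)"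
    by (simp add: es_def)
  also have "\<dots> = es S j (\<lambda>i. x (\<pi> i))"
    unfolding es_def using inj by (intro sum.cong refl) (auto simp: prod.reindex)
  finally show ?thesis .
qed

lemma es_permutes: "\<pi> permutes UNIV \<Longrightarrow> es UNIV j (\<lambda>i. x (\<pi> i)) = es UNIV j x"
  using es_reindex[of \<pi> UNIV j x] by (simp add: permutes_inj permutes_surj)

lemma es_omit_permutes:
  assumes "\<pi> permutes UNIV"
  shows "es (UNIV - {i}) j (\<lambda>i. x (\<pi> i)) = es (UNIV - {\<pi> i}) j x"
proof -
  have "\<pi> ` (UNIV - {i}) = UNIV - {\<pi> i}"
    using assms by (simp add: image_set_diff permutes_inj permutes_surj)
  then show ?thesis
    using es_reindex[of \<pi> "UNIV - {i}" j x] permutes_inj[OF assms] by (simp add: inj_on_subset)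
qed

lemma esym_eq_es: "esym j l = es UNIV j (($) l)"
  by (simp add: esym_def es_def)

text \<open>Zeroing a coordinate kills exactly the monomials that contain it.\<close>

lemma esym_omit_eq_es: "esym_omit j i l = es (UNIV - {i}) j (($) l)"
proof (cases j)
  case (Suc m)
  have "es (UNIV - {i}) j (\<lambda>m. if m = i then 0 else l $ m) = es (UNIV - {i}) j (($) l)" for j
    by (rule es_cong) auto
  moreover have "($) (\<chi> m. if m = i then 0 else l $ m) = (\<lambda>m. if m = i then 0 else l $ m)"
    by auto
  ultimately show ?thesis
    by (simp add: esym_omit_def esym_eq_es Suc es_remove[of UNIV i])
qed (simp add: esym_omit_def esym_eq_es)

lemma Gamma_cone_iff: "l \<in> Gamma_cone k \<longleftrightarrow> Gam k UNIV (($) l)"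
proof -
  have "(\<forall>j\<le>k. 0 < es UNIV j (($) l)) \<longleftrightarrow> (\<forall>j\<in>{1..k}. 0 < es UNIV j (($) l))"
    by (metis One_nat_def Suc_leI atLeastAtMost_iff es_0 finite neq0_conv zero_less_one)
  then show ?thesis by (simp add: Gamma_cone_def Gam_def esym_eq_es)
qed

lemma Gamma_bar_iff: "l \<in> Gamma_bar k \<longleftrightarrow> Gam_bar k UNIV (($) l)"
proof -
  have "(\<forall>j\<le>k. 0 \<le> es UNIV j (($) l)) \<longleftrightarrow> (\<forall>j\<in>{1..k}. 0 \<le> es UNIV j (($) l))"
    by (metis One_nat_def Suc_leI atLeastAtMost_iff es_0 finite neq0_conv zero_le_one)
  then show ?thesis by (simp add: Gamma_bar_def Gam_bar_def esym_eq_es)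
qed

subsection \<open>Diagonalisation\<close>

definition diag :: "('n \<Rightarrow> real) \<Rightarrow> real^'n^'n" where
  "diag d = (\<chi> i j. if i = j then d i else 0)"

lemma diag_mult_left: "(diag d ** A) $ i $ j = d i * A $ i $ j"
  by (simp add: diag_def matrix_matrix_mult_def if_distrib[of "\<lambda>x. x * _"] cong: if_cong)

lemma diag_mult_right: "(A ** diag d) $ i $ j = A $ i $ j * d j"
  by (simp add: diag_def matrix_matrix_mult_def if_distrib[of "\<lambda>x. _ * x"] cong: if_cong)

lemma transpose_diag [simp]: "transpose (diag d) = diag d"
  by (auto simp: diag_def transpose_def vec_eq_iff)

lemma symmetric_inner:
  fixes M :: "real^'n^'n"
  assumes "symmetric_mat M"
  shows "x \<bullet> (M *v y) = y \<bullet> (M *v x)"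
  using assms by (metis dot_lmul_matrix inner_commute symmetric_mat_def transpose_matrix_vector)

lemma conj_component:
  fixes M Q :: "real^'n^'n"
  shows "(transpose Q ** M ** Q) $ i $ j = column i Q \<bullet> (M *v column j Q)"
  by (simp add: matrix_matrix_mult_def transpose_def column_def inner_vec_def matrix_vector_mult_def
      sum_distrib_left sum_distrib_right mult.assoc) (rule sum.swap)

lemma orthogonal_matrix_columns:
  fixes Q :: "real^'n^'n"
  shows "orthogonal_matrix Q \<longleftrightarrow> (\<forall>i j. column i Q \<bullet> column j Q = (if i = j then 1 else 0))"
proof -
  have "(transpose Q ** Q) $ i $ j = column i Q \<bullet> column j Q" for i j
    using conj_component[of Q "mat 1"] by simp
  then show ?thesis by (simp add: orthogonal_matrix vec_eq_iff mat_def)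
qed

section \<open>Diagonalisation by minimising over orthogonal matrices\<close>

lemma compact_orthogonal_matrices: "compact {Q :: real^'n^'n. orthogonal_matrix Q}"
proof -
  have eq: "{Q :: real^'n^'n. orthogonal_matrix Q} =
     (\<Inter>i. \<Inter>j. {Q. (\<Sum>k\<in>UNIV. Q $ k $ i * Q $ k $ j) = (if i = j then 1 else 0)})"
    by (auto simp: orthogonal_matrix_columns column_def inner_vec_def)
  have closed: "closed {Q :: real^'n^'n. orthogonal_matrix Q}"
    unfolding eq by (intro closed_INT ballI closed_Collect_eq continuous_intros)
  have "norm Q \<le> real CARD('n) * real CARD('n)" if "orthogonal_matrix Q" for Q :: "real^'n^'n"
  proof -
    have "\<bar>Q $ i $ j\<bar> \<le> 1" for i j
    proof -
      have "column j Q \<bullet> column j Q = 1" using that by (simp add: orthogonal_matrix_columns)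
      then have "norm (column j Q) = 1" by (simp add: norm_eq_1)
      then show ?thesis using component_le_norm_cart[of "column j Q" i] by (simp add: column_def)
    qed
    then have "norm (Q $ i) \<le> real CARD('n)" for i
      using norm_le_l1_cart[of "Q $ i"] sum_mono[of UNIV "\<lambda>j. \<bar>Q $ i $ j\<bar>" "\<lambda>_. 1"] by simp
    then have "(\<Sum>i\<in>UNIV. norm (Q $ i)) \<le> (\<Sum>i\<in>(UNIV::'n set). real CARD('n))" by (intro sum_mono)
    moreover have "norm Q \<le> (\<Sum>i\<in>UNIV. norm (Q $ i))" unfolding norm_vec_def by (rule L2_set_le_sum) simp
    ultimately show ?thesis by simp
  qed
  then have "bounded {Q :: real^'n^'n. orthogonal_matrix Q}" by (auto simp: bounded_iff)
  with closed show ?thesis by (simp add: compact_eq_bounded_closed)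
qed

lemma quadratic_nonneg_imp_linear_zero:
  fixes p q :: real
  assumes "\<And>t. 0 \<le> t\<^sup>2 * p + 2 * t * q"
  shows "q = 0"
proof (rule ccontr)
  assume q: "q \<noteq> 0"
  \<comment> \<open>At -q/a, with \<open>a\<close> positive and at least \<open>p\<close>, the
    linear term outweighs the quadratic one.\<close>
  define a where "a = \<bar>p\<bar> + 1"
  have a: "0 < a" "p \<le> a" by (auto simp: a_def)
  have "0 \<le> (- q / a)\<^sup>2 * p + 2 * (- q / a) * q" by (rule assms)
  also have "\<dots> \<le> (- q / a)\<^sup>2 * a + 2 * (- q / a) * q" using a by (intro add_right_mono mult_left_mono) auto
  also have "\<dots> = - q\<^sup>2 / a" using a by (simp add: field_simps power2_eq_square)
  also have "\<dots> < 0" using a q by (simp add: field_simps)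
  finally show False by simp
qed

text \<open>A Givens rotation in the plane of two columns shows that a minimiser diagonalises \<open>M\<close>.\<close>

lemma orthogonal_minimiser_diagonalises:
  fixes M Q :: "real^'n^'n"
  assumes M: "symmetric_mat M" and Q: "orthogonal_matrix Q"
    and min: "\<And>R. orthogonal_matrix R \<Longrightarrow>
      (\<Sum>m\<in>UNIV. c m * (transpose Q ** M ** Q) $ m $ m) \<le> (\<Sum>m\<in>UNIV. c m * (transpose R ** M ** R) $ m $ m)"
    and ij: "i \<noteq> j" "c i \<noteq> c j"
  shows "(transpose Q ** M ** Q) $ i $ j = 0"
proof -
  let ?q = "\<lambda>m. column m Q"
  let ?b = "\<lambda>i j. ?q i \<bullet> (M *v ?q j)"
  have rot: "0 \<le> v\<^sup>2 * ((c i - c j) * (?b j j - ?b i i)) + 2 * (u * v) * ((c i - c j) * ?b i j)"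
    if uv: "u\<^sup>2 + v\<^sup>2 = 1" for u v
  proof -
    \<comment> \<open>Rotates columns \<open>i\<close> and \<open>j\<close> with cosine
      \<open>u\<close> and sine \<open>v\<close>.\<close>
    define w where "w m = (if m = i then u *\<^sub>R ?q i + v *\<^sub>R ?q j
       else if m = j then (- v) *\<^sub>R ?q i + u *\<^sub>R ?q j else ?q m)" for m
    define R :: "real^'n^'n" where "R = (\<chi> r m. w m $ r)"
    have col: "column m R = w m" for m by (simp add: R_def column_def vec_eq_iff)
    have q: "?q a \<bullet> ?q b = (if a = b then 1 else 0)" for a b
      using Q by (simp add: orthogonal_matrix_columns)
    have "w a \<bullet> w b = (if a = b then 1 else 0)" for a b
      using ij(1) uv by (auto simp: w_def inner_simps q power2_eq_square)
    then have "orthogonal_matrix R" by (simp add: orthogonal_matrix_columns col)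
    note min[OF this]
    also have "(\<Sum>m\<in>UNIV. c m * (transpose R ** M ** R) $ m $ m) =
        (\<Sum>m\<in>UNIV. c m * (w m \<bullet> (M *v w m)))" by (simp add: conj_component col)
    finally have "0 \<le> (\<Sum>m\<in>UNIV. c m * (w m \<bullet> (M *v w m)) - c m * ?b m m)"
      by (simp add: conj_component sum_subtractf)
    also have "\<dots> = (\<Sum>m\<in>{i, j}. c m * (w m \<bullet> (M *v w m)) - c m * ?b m m)"
      by (rule sum.mono_neutral_right) (auto simp: w_def)
    also have "\<dots> = c i * (w i \<bullet> (M *v w i) - ?b i i) + c j * (w j \<bullet> (M *v w j) - ?b j j)"
      using ij(1) by (simp add: algebra_simps)
    also have "w i \<bullet> (M *v w i) = u\<^sup>2 * ?b i i + 2 * (u * v) * ?b i j + v\<^sup>2 * ?b j j"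
      using symmetric_inner[OF M, of "?q j" "?q i"]
      by (simp add: w_def matrix_vector_right_distrib matrix_vector_mult_scaleR inner_simps
          power2_eq_square algebra_simps)
    also have "w j \<bullet> (M *v w j) = v\<^sup>2 * ?b i i - 2 * (u * v) * ?b i j + u\<^sup>2 * ?b j j"
      using symmetric_inner[OF M, of "?q j" "?q i"] ij(1)
      by (simp add: w_def matrix_vector_right_distrib matrix_vector_mult_scaleR inner_simps
          power2_eq_square algebra_simps matrix_vector_mult_diff_distrib)
    also have "u\<^sup>2 = 1 - v\<^sup>2" using uv by simp
    finally show ?thesis by (simp add: algebra_simps)
  qed
  have "0 \<le> t\<^sup>2 * ((c i - c j) * (?b j j - ?b i i)) + 2 * t * ((c i - c j) * ?b i j)" for t
  proof -
    \<comment> \<open>The angle has tangent \<open>t\<close>, so that after division by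
      \<open>u\<^sup>2\<close> the parameter is unconstrained.\<close>
    define u where "u = 1 / sqrt (1 + t\<^sup>2)"
    have pos: "0 < 1 + t\<^sup>2" by (simp add: add_pos_nonneg)
    have u: "u\<^sup>2 = 1 / (1 + t\<^sup>2)" using pos by (simp add: u_def power_divide)
    have "u\<^sup>2 + (t * u)\<^sup>2 = u\<^sup>2 * (1 + t\<^sup>2)" by (simp add: algebra_simps power_mult_distrib)
    also have "\<dots> = 1" using pos u by simp
    finally have "0 \<le> (t * u)\<^sup>2 * ((c i - c j) * (?b j j - ?b i i)) + 2 * (u * (t * u)) * ((c i - c j) * ?b i j)"
      by (rule rot)
    also have "\<dots> = u\<^sup>2 * (t\<^sup>2 * ((c i - c j) * (?b j j - ?b i i)) + 2 * t * ((c i - c j) * ?b i j))"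
      by (simp add: power2_eq_square algebra_simps)
    finally show ?thesis using u pos unfolding zero_le_mult_iff[of "u\<^sup>2"]
      by (metis divide_pos_pos linorder_not_le zero_less_one)
  qed
  then have "(c i - c j) * ?b i j = 0" by (rule quadratic_nonneg_imp_linear_zero)
  with ij(2) show ?thesis by (simp add: conj_component)
qed

text \<open>Compactness gives a minimiser, and pairwise distinct weights make every off-diagonal
  entry vanish.\<close>

lemma exists_diagonalising_minimiser:
  fixes M :: "real^'n^'n"
  assumes M: "symmetric_mat M" and c: "inj c"
  obtains Q d where "orthogonal_matrix Q" "transpose Q ** M ** Q = diag d"
    "\<forall>R. orthogonal_matrix R \<longrightarrow> (\<Sum>i\<in>UNIV. c i * d i) \<le> (\<Sum>i\<in>UNIV. c i * (transpose R ** M ** R) $ i $ i)"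
proof -
  let ?f = "\<lambda>Q. \<Sum>i\<in>UNIV. c i * (transpose Q ** M ** Q) $ i $ i"
  have "continuous_on {Q. orthogonal_matrix Q} ?f"
    unfolding matrix_matrix_mult_def transpose_def by (simp, intro continuous_intros)
  moreover have "{Q :: real^'n^'n. orthogonal_matrix Q} \<noteq> {}" using orthogonal_matrix_id by auto
  ultimately obtain Q where Q: "orthogonal_matrix Q" and min: "\<And>R. orthogonal_matrix R \<Longrightarrow> ?f Q \<le> ?f R"
    using continuous_attains_inf[OF compact_orthogonal_matrices, of ?f] by auto
  define d where "d i = (transpose Q ** M ** Q) $ i $ i" for i
  have "(transpose Q ** M ** Q) $ i $ j = 0" if "i \<noteq> j" for i j
    using orthogonal_minimiser_diagonalises[where c = c, OF M Q min that] c that by (auto simp: inj_eq)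
  then have "transpose Q ** M ** Q = diag d" by (auto simp: vec_eq_iff diag_def d_def)
  with Q min show ?thesis by (intro that[of Q d]) (auto simp: d_def)
qed

section \<open>Eigenvalues under orthogonal conjugation\<close>

lemma orthogonal_conj_eq_iff:
  fixes Q M D :: "real^'n^'n"
  assumes "orthogonal_matrix Q"
  shows "transpose Q ** M ** Q = D \<longleftrightarrow> M = Q ** D ** transpose Q"
proof -
  have Q: "transpose Q ** Q = mat 1" "Q ** transpose Q = mat 1"
    using assms by (auto simp: orthogonal_matrix_def)
  have "Q ** (transpose Q ** M ** Q) ** transpose Q = (Q ** transpose Q) ** M ** (Q ** transpose Q)"
    by (simp add: matrix_mul_assoc)
  moreover have "transpose Q ** (Q ** D ** transpose Q) ** Q = (transpose Q ** Q) ** D ** (transpose Q ** Q)"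
    by (simp add: matrix_mul_assoc)
  ultimately show ?thesis by (auto simp: Q)
qed

lemma prod_linear_eq_imp_permutes:
  fixes f g :: "'n::finite \<Rightarrow> real"
  assumes "(\<Prod>i\<in>UNIV. [:- f i, 1:]) = (\<Prod>i\<in>UNIV. [:- g i, 1:])"
  obtains \<pi> where "\<pi> permutes UNIV" "f = (\<lambda>i. g (\<pi> i))"
proof -
  have roots: "proots (\<Prod>i\<in>A. [:- h i, 1:]) = image_mset h (mset_set A)" if "finite A"
    for A and h :: "'n \<Rightarrow> real"
    using that by (induction A rule: finite_induct) (simp_all add: proots_mult del: mult_pCons_left)
  have "image_mset f (mset_set UNIV) = image_mset g (mset_set UNIV)"
    unfolding roots[OF finite, symmetric] assms by (rule refl)
  from image_mset_eq_implies_permutes[OF finite this]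
  obtain p where "p permutes UNIV" "\<forall>x\<in>UNIV. f x = g (p x)" .
  then show ?thesis by (intro that[of p]) auto
qed

text \<open>The characteristic polynomial is invariant under the conjugation; since
  \<open>eigenvalues\<close> picks an arbitrary order, agreement is only up to a
  permutation.\<close>

lemma eigenvalues_diag_conj:
  fixes Q M :: "real^'n^'n"
  assumes Q: "orthogonal_matrix Q" and M: "symmetric_mat M" "transpose Q ** M ** Q = diag d"
  obtains \<pi> where "\<pi> permutes UNIV" "d = (\<lambda>i. eigenvalues M $ \<pi> i)"
proof -
  have "poly (charpoly M) x = poly (\<Prod>i\<in>UNIV. [:- d i, 1:]) x" for x
  proof -
    have "transpose Q ** (mat x - M) ** Q = mat x - diag d"
    proof -
      have "transpose Q ** (mat x - M) ** Q = transpose Q ** mat x ** Q - transpose Q ** M ** Q"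
        by (simp add: vec_eq_iff matrix_matrix_mult_def sum_subtractf algebra_simps sum_distrib_right)
      also have "transpose Q ** mat x ** Q = mat x"
      proof -
        have "mat x ** Q = Q ** mat x" 
          by (simp add: vec_eq_iff matrix_matrix_mult_def mat_def if_distrib[of "\<lambda>x. _ * x"]
              if_distrib[of "\<lambda>x. x * _"] cong: if_cong)
        then show ?thesis using Q by (metis matrix_mul_assoc matrix_mul_lid orthogonal_matrix_def)
      qed
      finally show ?thesis by (simp add: M)
    qed
    moreover have "mat x - diag d = (diag (\<lambda>i. x - d i) :: real^'n^'n)"
      by (auto simp: vec_eq_iff mat_def diag_def)
    ultimately have "det (transpose Q) * det (mat x - M) * det Q = det (diag (\<lambda>i. x - d i) :: real^'n^'n)"
      by (metis det_mul)
    moreover have "det (transpose Q) * det Q = 1"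
      using Q by (metis det_I det_mul orthogonal_matrix_def)
    ultimately have "det (mat x - M) = det (diag (\<lambda>i. x - d i) :: real^'n^'n)"
      by (metis mult.assoc mult.commute mult_1)
    also have "\<dots> = (\<Prod>i\<in>UNIV. x - d i)"
      by (subst det_diagonal) (auto simp: diag_def)
    finally show ?thesis by (simp add: poly_charpoly poly_prod)
  qed
  then have "charpoly M = (\<Prod>i\<in>UNIV. [:- d i, 1:])"
    by (simp add: poly_eq_poly_eq_iff[symmetric] fun_eq_iff)
  then have "(\<Prod>i\<in>UNIV. [:- d i, 1:]) = (\<Prod>i\<in>UNIV. [:- (eigenvalues M $ i), 1:])"
    using charpoly_eigenvalues[OF M(1)] by simp
  from prod_linear_eq_imp_permutes[OF this] that show ?thesis by blast
qed

lemma exists_inj_real: obtains h :: "'n::finite \<Rightarrow> real" where "inj h"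
proof -
  obtain f :: "'n \<Rightarrow> nat" where "inj f"
    using finite_imp_inj_to_nat_seg[of "UNIV :: 'n set"] by auto
  then have "inj (\<lambda>i. real (f i))" by (auto simp: inj_def)
  then show ?thesis by (rule that)
qed

text \<open>The spectral theorem as a by-product of the minimisation, for any choice of distinct
  weights.\<close>

lemma symmetric_diagonalisable:
  fixes M :: "real^'n^'n"
  assumes M: "symmetric_mat M"
  obtains Q \<pi> where "orthogonal_matrix Q" "\<pi> permutes UNIV"
    "transpose Q ** M ** Q = diag (\<lambda>i. eigenvalues M $ \<pi> i)"
proof -
  obtain c :: "'n \<Rightarrow> real" where "inj c" using exists_inj_real .
  then obtain Q d where Q: "orthogonal_matrix Q" "transpose Q ** M ** Q = diag d"
    using exists_diagonalising_minimiser[OF M] by blast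
  obtain \<pi> where "\<pi> permutes UNIV" "d = (\<lambda>i. eigenvalues M $ \<pi> i)"
    using eigenvalues_diag_conj[OF Q(1) M Q(2)] .
  with Q that show ?thesis by blast
qed

text \<open>For distinct weights this is the property of the diagonalising minimiser. Coinciding
  weights are first separated by a small perturbation, under which the finitely many strict
  inequalities of the negation persist.\<close>

lemma eigenvalue_rearrangement:
  fixes M R :: "real^'n^'n"
  assumes M: "symmetric_mat M" and R: "orthogonal_matrix R"
  shows "\<exists>\<pi>. \<pi> permutes UNIV \<and>
    (\<Sum>i\<in>UNIV. c i * eigenvalues M $ \<pi> i) \<le> (\<Sum>i\<in>UNIV. c i * (transpose R ** M ** R) $ i $ i)"
proof (rule ccontr)
  let ?d = "\<lambda>i. (transpose R ** M ** R) $ i $ i"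
  let ?P = "{\<pi> :: 'n \<Rightarrow> 'n. \<pi> permutes UNIV}"
  assume "\<not> ?thesis"
  then have less: "(\<Sum>i\<in>UNIV. c i * ?d i) < (\<Sum>i\<in>UNIV. c i * eigenvalues M $ \<pi> i)" if "\<pi> \<in> ?P" for \<pi>
    using that by force
  obtain h :: "'n \<Rightarrow> real" where h: "inj h" using exists_inj_real .
  \<comment> \<open>As \<open>h\<close> is injective, coinciding weights separate for every positive
    \<open>e\<close>, while distinct ones stay apart for small \<open>e\<close>.\<close>
  define c' where "c' e i = c i + e * h i" for e i
  have lim: "((\<lambda>e. \<Sum>i\<in>UNIV. c' e i * x i) \<longlongrightarrow> (\<Sum>i\<in>UNIV. c i * x i)) (at_right 0)" for x
  proof -
    have "((\<lambda>e. \<Sum>i\<in>UNIV. c' e i * x i) \<longlongrightarrow> (\<Sum>i\<in>UNIV. (c i + 0 * h i) * x i)) (at_right 0)"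
      unfolding c'_def by (intro tendsto_intros)
    then show ?thesis by simp
  qed
  have "\<forall>\<^sub>F e in at_right 0. (\<Sum>i\<in>UNIV. c' e i * ?d i) < (\<Sum>i\<in>UNIV. c' e i * eigenvalues M $ \<pi> i)"
    if "\<pi> \<in> ?P" for \<pi>
  proof -
    have "((\<lambda>e. (\<Sum>i\<in>UNIV. c' e i * eigenvalues M $ \<pi> i) - (\<Sum>i\<in>UNIV. c' e i * ?d i)) \<longlongrightarrow>
      (\<Sum>i\<in>UNIV. c i * eigenvalues M $ \<pi> i) - (\<Sum>i\<in>UNIV. c i * ?d i)) (at_right 0)"
      by (intro tendsto_diff lim)
    from order_tendstoD(1)[OF this, of 0] less[OF that] show ?thesis by simp
  qed
  then have "\<forall>\<^sub>F e in at_right 0. \<forall>\<pi>\<in>?P. (\<Sum>i\<in>UNIV. c' e i * ?d i) < (\<Sum>i\<in>UNIV. c' e i * eigenvalues M $ \<pi> i)"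
    by (intro eventually_ball_finite) auto
  moreover have "\<forall>\<^sub>F e in at_right 0. \<forall>i. \<forall>j\<in>- {i}. c' e i \<noteq> c' e j"
  proof (intro eventually_all_finite eventually_ball_finite ballI)
    fix i j :: 'n assume j: "j \<in> - {i}"
    show "\<forall>\<^sub>F e in at_right 0. c' e i \<noteq> c' e j"
    proof (cases "c i = c j")
      case True
      have "h i \<noteq> h j" using h j by (auto simp: inj_eq)
      with True show ?thesis
        by (intro eventually_mono[OF eventually_at_right_less[of "0::real"]]) (simp add: c'_def)
    next
      case False
      have "((\<lambda>e. c' e i - c' e j) \<longlongrightarrow> (c i + 0 * h i) - (c j + 0 * h j)) (at_right 0)"
        unfolding c'_def by (intro tendsto_intros)
      from tendsto_imp_eventually_ne[OF this, of 0] False show ?thesis by simp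
    qed
  qed simp
  ultimately obtain e where e: "\<forall>\<pi>\<in>?P. (\<Sum>i\<in>UNIV. c' e i * ?d i) < (\<Sum>i\<in>UNIV. c' e i * eigenvalues M $ \<pi> i)"
    and "\<forall>i. \<forall>j\<in>- {i}. c' e i \<noteq> c' e j"
    using eventually_happens'[OF trivial_limit_at_right_real eventually_conj] by blast
  then have "inj (c' e)" by (auto simp: inj_def)
  then obtain Q d where Q: "orthogonal_matrix Q" "transpose Q ** M ** Q = diag d"
    and min: "(\<Sum>i\<in>UNIV. c' e i * d i) \<le> (\<Sum>i\<in>UNIV. c' e i * ?d i)"
    using exists_diagonalising_minimiser[OF M] R by blast
  obtain \<pi> where "\<pi> permutes UNIV" "d = (\<lambda>i. eigenvalues M $ \<pi> i)"
    using eigenvalues_diag_conj[OF Q(1) M Q(2)] .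
  with min e show False by force
qed

subsection \<open>The trace functional\<close>

text \<open>\<open>A\<close> is symmetric, being orthogonally conjugate to a diagonal matrix, and
  cyclicity of the trace removes the outer factors \<open>Q\<close>.\<close>

lemma trace_conj_diag:
  fixes M Q A :: "real^'n^'n"
  assumes Q: "orthogonal_matrix Q" and A: "transpose Q ** A ** Q = diag a"
  shows "trace (transpose A ** M ** A) = (\<Sum>i\<in>UNIV. (a i)\<^sup>2 * (transpose Q ** M ** Q) $ i $ i)"
proof -
  have A': "A = Q ** diag a ** transpose Q" using A orthogonal_conj_eq_iff[OF Q] by blast
  have "transpose A = A" by (simp add: A' matrix_transpose_mul matrix_mul_assoc)
  then have "trace (transpose A ** M ** A) = trace (Q ** (diag a ** (transpose Q ** M ** Q) ** diag a ** transpose Q))"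
    by (simp add: A' matrix_mul_assoc)
  also have "\<dots> = trace (diag a ** (transpose Q ** M ** Q) ** diag a ** (transpose Q ** Q))"
    by (subst trace_mul_sym) (simp add: matrix_mul_assoc)
  also have "\<dots> = trace (diag a ** (transpose Q ** M ** Q) ** diag a)"
    using Q by (simp add: orthogonal_matrix)
  also have "\<dots> = (\<Sum>i\<in>UNIV. (a i)\<^sup>2 * (transpose Q ** M ** Q) $ i $ i)"
    by (simp add: trace_def diag_mult_left diag_mult_right power2_eq_square mult_ac)
  finally show ?thesis .
qed

lemma psd_diag_conj:
  fixes Q :: "real^'n^'n"
  assumes "\<And>i. 0 \<le> a i"
  shows "psd_mat (Q ** diag a ** transpose Q)"
  unfolding psd_mat_def symmetric_mat_def
proof (intro conjI allI)
  show "transpose (Q ** diag a ** transpose Q) = Q ** diag a ** transpose Q"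
    by (simp add: matrix_transpose_mul matrix_mul_assoc)
  fix x :: "real^'n"
  define y where "y = transpose Q *v x"
  have "x \<bullet> ((Q ** diag a ** transpose Q) *v x) = x \<bullet> (Q *v (diag a *v y))"
    by (simp only: y_def matrix_vector_mul_assoc matrix_mul_assoc)
  also have "\<dots> = y \<bullet> (diag a *v y)"
    by (metis dot_lmul_matrix transpose_matrix_vector y_def)
  also have "\<dots> = (\<Sum>i\<in>UNIV. y $ i * (a i * y $ i))"
    by (simp add: inner_vec_def matrix_vector_mult_def diag_def if_distrib[of "\<lambda>x. x * _"] cong: if_cong)
  also have "\<dots> = (\<Sum>i\<in>UNIV. a i * (y $ i)\<^sup>2)"
    by (simp add: power2_eq_square mult_ac)
  also have "\<dots> \<ge> 0" using assms by (intro sum_nonneg) auto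
  finally show "0 \<le> x \<bullet> ((Q ** diag a ** transpose Q) *v x)" .
qed

lemma trace_nonneg_of_Gamma_bar:
  fixes A M :: "real^'n^'n"
  assumes k: "0 < k" "k \<le> CARD('n)" and A: "A \<in> A_set k"
    and M: "symmetric_mat M" "eigenvalues M \<in> Gamma_bar k"
  shows "0 \<le> trace (transpose A ** M ** A)"
proof -
  obtain \<gamma> where \<gamma>: "Gam k UNIV (($) \<gamma>)"
    and ev: "\<And>i. (eigenvalues A $ i)\<^sup>2 = es (UNIV - {i}) (k - 1) (($) \<gamma>)"
    using A by (auto simp: A_set_def Gamma_cone_iff esym_omit_eq_es)
  have "symmetric_mat A" using A by (simp add: A_set_def psd_mat_def)
  then obtain Q \<pi> where Q: "orthogonal_matrix Q" and \<pi>: "\<pi> permutes UNIV"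
    and QA: "transpose Q ** A ** Q = diag (\<lambda>i. eigenvalues A $ \<pi> i)"
    using symmetric_diagonalisable by blast
  \<comment> \<open>Permuting \<open>\<gamma>\<close> by \<open>\<pi>\<close> matches the weights to
    the columns of \<open>Q\<close>.\<close>
  define c where "c i = es (UNIV - {i}) (k - 1) (\<lambda>i. \<gamma> $ \<pi> i)" for i
  have tr: "trace (transpose A ** M ** A) = (\<Sum>i\<in>UNIV. c i * (transpose Q ** M ** Q) $ i $ i)"
    by (simp add: trace_conj_diag[OF Q QA] ev c_def es_omit_permutes[OF \<pi>])
  obtain \<tau> where \<tau>: "\<tau> permutes UNIV"
    and le: "(\<Sum>i\<in>UNIV. c i * eigenvalues M $ \<tau> i) \<le> (\<Sum>i\<in>UNIV. c i * (transpose Q ** M ** Q) $ i $ i)"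
    using eigenvalue_rearrangement[OF M(1) Q] by blast
  have "Gam k UNIV (\<lambda>i. \<gamma> $ \<pi> i)"
    using \<gamma> es_permutes[OF \<pi>, of _ "($) \<gamma>"] by (simp add: Gam_def)
  moreover have "Gam_bar k UNIV (\<lambda>i. eigenvalues M $ \<tau> i)"
    using M(2) es_permutes[OF \<tau>, of _ "($) (eigenvalues M)"] by (simp add: Gamma_bar_iff Gam_bar_def)
  ultimately have "0 \<le> (\<Sum>i\<in>UNIV. c i * eigenvalues M $ \<tau> i)"
    using garding[of "UNIV :: 'n set" "k - 1" "\<lambda>i. \<gamma> $ \<pi> i" "\<lambda>i. eigenvalues M $ \<tau> i"] k by (simp add: c_def)
  with le tr show ?thesis by simp
qed

text \<open>The test matrix shares the eigenbasis \<open>Q\<close> of \<open>M\<close> and has the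
  square roots of the weights as eigenvalues, so its trace value is the sum in
  \<open>garding_unbounded\<close>.\<close>

lemma trace_unbounded:
  fixes M :: "real^'n^'n"
  assumes k: "2 \<le> k" "k \<le> CARD('n)" and M: "symmetric_mat M" "eigenvalues M \<notin> Gamma_bar k"
  shows "\<exists>A\<in>A_set k. trace (transpose A ** M ** A) < B"
proof -
  obtain Q \<tau> where Q: "orthogonal_matrix Q" and \<tau>: "\<tau> permutes UNIV"
    and QM: "transpose Q ** M ** Q = diag (\<lambda>i. eigenvalues M $ \<tau> i)"
    using symmetric_diagonalisable[OF M(1)] by blast
  have "\<not> Gam_bar k UNIV (\<lambda>i. eigenvalues M $ \<tau> i)"
    using M(2) es_permutes[OF \<tau>, of _ "($) (eigenvalues M)"] by (simp add: Gamma_bar_iff Gam_bar_def)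
  from garding_unbounded[OF finite _ k(1) this] k(2)
  obtain \<gamma> :: "'n \<Rightarrow> real" where \<gamma>: "Gam k UNIV \<gamma>" "es UNIV k \<gamma> = 1"
    and less: "(\<Sum>i\<in>UNIV. es (UNIV - {i}) (k - 1) \<gamma> * eigenvalues M $ \<tau> i) < B"
    by blast
  define a where "a i = sqrt (es (UNIV - {i}) (k - 1) \<gamma>)" for i
  have nonneg: "0 \<le> es (UNIV - {i}) (k - 1) \<gamma>" for i
  proof -
    have "Gam (k - 1) (UNIV - {i}) \<gamma>" using Gam_omit[of UNIV i "k - 1" \<gamma>] \<gamma>(1) k by simp
    then show ?thesis by (simp add: Gam_def less_imp_le)
  qed
  have a2: "(a i)\<^sup>2 = es (UNIV - {i}) (k - 1) \<gamma>" for i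
    unfolding a_def by (rule real_sqrt_pow2[OF nonneg])
  define A where "A = Q ** diag a ** transpose Q"
  have QA: "transpose Q ** A ** Q = diag a" using orthogonal_conj_eq_iff[OF Q] A_def by blast
  have psd: "psd_mat A" unfolding A_def by (rule psd_diag_conj) (unfold a_def, intro real_sqrt_ge_zero nonneg)
  obtain \<pi> where \<pi>: "\<pi> permutes UNIV" and ev: "a = (\<lambda>i. eigenvalues A $ \<pi> i)"
    using eigenvalues_diag_conj[OF Q _ QA] psd psd_mat_def by blast
  have \<pi>': "inv \<pi> permutes UNIV" using \<pi> by (rule permutes_inv)
  \<comment> \<open>\<open>eigenvalues A\<close> lists the entries of \<open>a\<close> in an order
    known only up to \<open>\<pi>\<close>, so \<open>\<gamma>\<close> is reordered to fit
    it.\<close>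
  define g :: "real^'n" where "g = (\<chi> i. \<gamma> (inv \<pi> i))"
  have g: "($) g = (\<lambda>i. \<gamma> (inv \<pi> i))" by (auto simp: g_def)
  have "eigenvalues A $ i = a (inv \<pi> i)" for i using \<pi> by (simp add: ev permutes_inverses)
  then have "(eigenvalues A $ i)\<^sup>2 = esym_omit (k - 1) i g" for i
    by (simp add: a2 esym_omit_eq_es g es_omit_permutes[OF \<pi>'])
  moreover have "g \<in> Gamma_cone k" "esym k g = 1"
    using \<gamma> by (simp_all add: Gamma_cone_iff Gam_def esym_eq_es g es_permutes[OF \<pi>'])
  ultimately have "A \<in> A_set k" using psd by (auto simp: A_set_def)
  moreover have "trace (transpose A ** M ** A) = (\<Sum>i\<in>UNIV. es (UNIV - {i}) (k - 1) \<gamma> * eigenvalues M $ \<tau> i)"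
    by (simp add: trace_conj_diag[OF Q QA] QM a2 diag_def)
  ultimately show ?thesis using less by (intro bexI[of _ A]) simp_all
qed

section \<open>Equality of the two matrix cones\<close>

theorem corollary5p3:
  fixes k :: nat
  assumes "2 \<le> k" and "k \<le> CARD('n::finite)"
  shows
    "(\<forall>(\<Omega> :: (real^'n) set) u. open \<Omega> \<longrightarrow> C2_on \<Omega> u \<longrightarrow>
        (k_convex k \<Omega> u \<longleftrightarrow> admissible (A_set k) \<Omega> u)) \<and>
     Gamma_A (A_set k) = (Gamma_bar_mat k :: (real^'n^'n) set) \<and>
     (\<forall>M :: real^'n^'n. symmetric_mat M \<longrightarrow>
        ((INF A\<in>A_set k. ereal (trace (transpose A ** M ** A))) > -\<infinity> \<longleftrightarrow>
         eigenvalues M \<in> Gamma_bar k))"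
proof -
  have iff: "(INF A\<in>A_set k. ereal (trace (transpose A ** M ** A))) > -\<infinity> \<longleftrightarrow> eigenvalues M \<in> Gamma_bar k"
    if M: "symmetric_mat M" for M :: "real^'n^'n"
  proof
    assume "eigenvalues M \<in> Gamma_bar k"
    then have "0 \<le> (INF A\<in>A_set k. ereal (trace (transpose A ** M ** A)))"
      using trace_nonneg_of_Gamma_bar[OF _ assms(2) _ M] assms(1) by (intro INF_greatest) simp
    then show "(INF A\<in>A_set k. ereal (trace (transpose A ** M ** A))) > -\<infinity>" by auto
  next
    assume inf: "(INF A\<in>A_set k. ereal (trace (transpose A ** M ** A))) > -\<infinity>"
    show "eigenvalues M \<in> Gamma_bar k"
    proof (rule ccontr)
      assume "eigenvalues M \<notin> Gamma_bar k"
      then have "\<exists>A\<in>A_set k. ereal (trace (transpose A ** M ** A)) < ereal B" for B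
        using trace_unbounded[OF assms M] by simp
      then have "(INF A\<in>A_set k. ereal (trace (transpose A ** M ** A))) < ereal B" for B
        unfolding INF_less_iff .
      then have "(INF A\<in>A_set k. ereal (trace (transpose A ** M ** A))) = -\<infinity>"
        by (intro ereal_bot less_imp_le)
      with inf show False by simp
    qed
  qed
  then have "Gamma_A (A_set k) = (Gamma_bar_mat k :: (real^'n^'n) set)"
    by (auto simp: Gamma_A_def Gamma_bar_mat_def)
  \<comment> \<open>Both function classes are pointwise conditions on the Hessian, so equality of
    the cones settles them.\<close>
  with iff show ?thesis by (simp add: k_convex_def admissible_def)
qed

end
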